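(* Let $\mathcal{B}$ be a unital topological algebra over $\mathbb{C}$ and let $f:\mathbb{C}^n\to\mathcal{B}$ be an entire function, with resolvent set $\sigma_f^c=\{z\in\mathbb{C}^n: f(z)\text{ is invertible in }\mathcal{B}\}$ and $\omega_f=f^{-1}df$; assume that $\sigma_f^c$ is nonempty and open and that $\omega_f$ is holomorphic on it. Then for every $p\ge 0$ the map $\kappa(\phi)=\phi(\omega_f,\omega_f,\dots,\omega_f)$ on continuous cyclic cochains induces a homomorphism $[\phi]\mapsto[\kappa(\phi)]$ from the cyclic cohomology $HC^{p}(\mathcal{B})$ into the de Rham cohomology $H^{p+1}_d(\sigma_f^c,\mathbb{C})$.
   Context: A topological algebra is an associative algebra over $\mathbb{C}$ with a vector space topology for which multiplication is continuous. For $q\ge 0$, $C^q(\mathcal{B})$ is the space of continuous $(q+1)$-linear functionals on $\mathcal{B}$, and $C^q_\lambda(\mathcal{B})\subset C^q(\mathcal{B})$ is the subspace of cyclic ones, i.e. those with $\phi(a_0,a_1,\dots,a_q)=(-1)^q\phi(a_q,a_0,\dots,a_{q-1})$. The coboundary $b$ sends a continuous $p$-linear functional $\phi$ ($p\ge1$) to the $(p+1)$-linear functional $$(b\phi)(\alpha_1,\dots,\alpha_{p+1})=\sum_{j=1}^{p}(-1)^{j-1}\phi(\alpha_1,\dots,\alpha_j\alpha_{j+1},\dots,\alpha_{p+1})+(-1)^p\phi(\alpha_{p+1}\alpha_1,\alpha_2,\dots,\alpha_p).$$ By Connes, $b$ maps cyclic cochains to cyclic cochains, so $(C^*_\lambda(\mathcal{B}),b)$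 is a complex (with zero map into $C^0_\lambda$); $HC^p(\mathcal{B})$ is its $p$-th cohomology space. Write $\omega_f=\sum_{i=1}^n B_i\,dz_i$ with $B_i(z)=f(z)^{-1}\frac{\partial f}{\partial z_i}(z)$, a $\mathcal{B}$-valued 1-form on $\sigma_f^c$. For a $k$-linear functional $F$ and $\mathcal{B}$-valued forms $\eta_j=\sum_I a^j_I\,dz_I$, put $F(\eta_1,\dots,\eta_k)=\sum_{I_1,\dots,I_k}F(a^1_{I_1},\dots,a^k_{I_k})\,dz_{I_1}\wedge\dots\wedge dz_{I_k}$. For $\phi\in C^p_\lambda(\mathcal{B})$, $\kappa(\phi)=\phi(\omega_f,\dots,\omega_f)$ ($p+1$ entries) is a smooth complex $(p+1)$-form on $\sigma_f^c$. $H^*_d(D,\mathbb{C})$ denotes de Rham cohomology of $D$ with complex coefficients. *)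

theory Defs
  imports "HOL-Analysis.Analysis" "HOL-Library.Function_Algebras" "HOL-Library.Set_Algebras"
begin

section \<open>Complex vector spaces and topological algebras\<close>

class scaleC =
  fixes scaleC :: "complex \<Rightarrow> 'a \<Rightarrow> 'a" (infixr "*\<^sub>C" 75)

class complex_vector = scaleC + ab_group_add +
  assumes scaleC_add_right: "c *\<^sub>C (x + y) = c *\<^sub>C x + c *\<^sub>C y"
    and scaleC_add_left: "(c + d) *\<^sub>C x = c *\<^sub>C x + d *\<^sub>C x"
    and scaleC_scaleC: "c *\<^sub>C d *\<^sub>C x = (c * d) *\<^sub>C x"
    and scaleC_one: "1 *\<^sub>C x = x"

instantiation complex :: complex_vector
begin

definition scaleC_complex :: "complex \<Rightarrow> complex \<Rightarrow> complex" where
  "scaleC_complex c x = c * x"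

instance
  by standard (simp_all add: scaleC_complex_def algebra_simps)

end

instantiation "fun" :: (type, complex_vector) complex_vector
begin

definition scaleC_fun :: "complex \<Rightarrow> ('a \<Rightarrow> 'b) \<Rightarrow> 'a \<Rightarrow> 'b" where
  "scaleC_fun c f = (\<lambda>x. c *\<^sub>C f x)"

instance
  by standard
    (simp_all add: scaleC_fun_def plus_fun_def scaleC_add_right scaleC_add_left
      scaleC_scaleC scaleC_one)

end

text \<open>
  Unital topological algebras over the complex numbers. The topology is an arbitrary vector
  space topology: neither Hausdorff nor locally convex nor complete. The type class
  \<^class>\<open>ring_1\<close> is avoided because it excludes the zero algebra.
\<close>

class topological_complex_algebra =
  complex_vector + ring + topological_ab_group_add + topological_monoid_mult +
  assumes mult_scaleC_left: "(c *\<^sub>C x) * y = c *\<^sub>C (x * y)"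
    and mult_scaleC_right: "x * (c *\<^sub>C y) = c *\<^sub>C (x * y)"
    and tendsto_scaleC_Pair:
      "LIM u (nhds c \<times>\<^sub>F nhds x). fst u *\<^sub>C snd u :> nhds (c *\<^sub>C x)"

definition is_invertible :: "'b::monoid_mult \<Rightarrow> bool" where
  "is_invertible a \<longleftrightarrow> (\<exists>b. a * b = 1 \<and> b * a = 1)"

definition alg_inverse :: "'b::monoid_mult \<Rightarrow> 'b" where
  "alg_inverse a = (THE b. a * b = 1 \<and> b * a = 1)"


section \<open>Holomorphic functions of several variables with values in a topological algebra\<close>

definition has_cpartial ::
  "(complex^'n \<Rightarrow> 'b::topological_complex_algebra) \<Rightarrow> 'n \<Rightarrow> complex^'n \<Rightarrow> 'b \<Rightarrow> bool" where
  "has_cpartial f i z D \<longleftrightarrow>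
     ((\<lambda>t::complex. inverse t *\<^sub>C (f (z + axis i t) - f z)) \<longlongrightarrow> D) (at 0)"

text \<open>
  If the topology is not Hausdorff, a partial derivative is determined only up to an element
  of the closure of 0 (on which continuous multilinear functionals vanish in each argument),
  and one of the possible values is chosen.
\<close>

definition cpartial ::
  "(complex^'n \<Rightarrow> 'b::topological_complex_algebra) \<Rightarrow> 'n \<Rightarrow> complex^'n \<Rightarrow> 'b" where
  "cpartial f i z = (SOME D. has_cpartial f i z D)"

text \<open>
  Holomorphic means continuous and complex differentiable in each variable, the limits of the
  difference quotients being taken in the topology of the algebra. It is meant for open sets.
\<close>

definition holomorphic_tva ::
  "(complex^'n \<Rightarrow> 'b::topological_complex_algebra) \<Rightarrow> (complex^'n) set \<Rightarrow> bool" where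
  "holomorphic_tva f U \<longleftrightarrow>
     continuous_on U f \<and> (\<forall>z\<in>U. \<forall>i. \<exists>D. has_cpartial f i z D)"

definition resolvent_set ::
  "(complex^'n \<Rightarrow> 'b::topological_complex_algebra) \<Rightarrow> (complex^'n) set" where
  "resolvent_set f = {z. is_invertible (f z)}"

text \<open>An algebra-valued 1-form is given by its family of coefficients with respect to the
  \<open>dz\<^sub>i\<close>.\<close>

definition omega ::
  "(complex^'n \<Rightarrow> 'b::topological_complex_algebra) \<Rightarrow> 'n \<Rightarrow> complex^'n \<Rightarrow> 'b" where
  "omega f i z = alg_inverse (f z) * cpartial f i z"


section \<open>Quotients of subspaces\<close>

text \<open>
  For subspaces \<open>N \<subseteq> Z\<close>, the elements of \<open>Z / N\<close> are the cosets \<open>x +o N\<close>; they are added as sets.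
  The summand \<open>N\<close> in the scalar multiple is needed when the scalar is 0.
\<close>

definition quotient_space :: "'a::plus set \<Rightarrow> 'a set \<Rightarrow> 'a set set" where
  "quotient_space Z N = (\<lambda>x. x +o N) ` Z"

definition coset_scale :: "'a::complex_vector set \<Rightarrow> complex \<Rightarrow> 'a set \<Rightarrow> 'a set" where
  "coset_scale N c X = (\<lambda>x. c *\<^sub>C x) ` X + N"

definition quotient_hom ::
  "'a::complex_vector set \<Rightarrow> 'a set \<Rightarrow> 'c::complex_vector set \<Rightarrow> 'c set \<Rightarrow> ('a set \<Rightarrow> 'c set) \<Rightarrow> bool"
  where
  "quotient_hom Z N Z' N' h \<longleftrightarrow>
     h ` quotient_space Z N \<subseteq> quotient_space Z' N' \<and>
     (\<forall>X\<in>quotient_space Z N. \<forall>Y\<in>quotient_space Z N. h (X + Y) = h X + h Y) \<and>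
     (\<forall>c. \<forall>X\<in>quotient_space Z N. h (coset_scale N c X) = coset_scale N' c (h X))"


section \<open>Cyclic cohomology\<close>

text \<open>
  A \<open>k\<close>-linear functional is a function on lists which is 0 on lists of length other than \<open>k\<close>,
  so that equality of such functions is equality of functionals. Continuity is joint continuity
  on the \<open>k\<close>-fold topological product.
\<close>

definition cont_multilinear :: "nat \<Rightarrow> ('b::topological_complex_algebra list \<Rightarrow> complex) set" where
  "cont_multilinear k = {\<phi>.
     (\<forall>as. length as \<noteq> k \<longrightarrow> \<phi> as = 0) \<and>
     (\<forall>as i. length as = k \<longrightarrow> i < k \<longrightarrow>
        Vector_Spaces.linear scaleC scaleC (\<lambda>x. \<phi> (as[i := x]))) \<and>
     continuous_map (product_topology (\<lambda>_::nat. euclidean) {..<k}) euclidean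
        (\<lambda>a. \<phi> (map a [0..<k]))}"

definition cyclic_cochains :: "nat \<Rightarrow> ('b::topological_complex_algebra list \<Rightarrow> complex) set" where
  "cyclic_cochains q = {\<phi> \<in> cont_multilinear (Suc q).
     \<forall>as. length as = Suc q \<longrightarrow> \<phi> as = (- 1) ^ q * \<phi> (last as # butlast as)}"

text \<open>The coboundary of a \<open>p\<close>-linear functional, \<open>p \<ge> 1\<close>, with arguments indexed from 0.\<close>

definition hochschild_b ::
  "nat \<Rightarrow> ('b::topological_complex_algebra list \<Rightarrow> complex) \<Rightarrow> 'b list \<Rightarrow> complex" where
  "hochschild_b p \<phi> as =
     (if length as = Suc p then
        (\<Sum>j<p. (- 1) ^ j * \<phi> (take j as @ (as ! j * as ! Suc j) # drop (j + 2) as))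
        + (- 1) ^ p * \<phi> ((as ! p * as ! 0) # butlast (tl as))
      else 0)"

definition cyclic_cocycles :: "nat \<Rightarrow> ('b::topological_complex_algebra list \<Rightarrow> complex) set" where
  "cyclic_cocycles q = {\<phi> \<in> cyclic_cochains q. hochschild_b (Suc q) \<phi> = 0}"

definition cyclic_coboundaries ::
  "nat \<Rightarrow> ('b::topological_complex_algebra list \<Rightarrow> complex) set" where
  "cyclic_coboundaries q =
     (case q of 0 \<Rightarrow> {0} | Suc r \<Rightarrow> hochschild_b (Suc r) ` cyclic_cochains r)"


section \<open>De Rham cohomology of open sets, with complex coefficients\<close>

fun Ck_on :: "nat \<Rightarrow> ('v::euclidean_space \<Rightarrow> complex) \<Rightarrow> 'v set \<Rightarrow> bool" where
  "Ck_on 0 g U \<longleftrightarrow> continuous_on U g"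
| "Ck_on (Suc k) g U \<longleftrightarrow>
     (\<forall>x\<in>U. g differentiable (at x)) \<and>
     (\<forall>v. Ck_on k (\<lambda>x. frechet_derivative g (at x) v) U)"

definition smooth_on :: "('v::euclidean_space \<Rightarrow> complex) \<Rightarrow> 'v set \<Rightarrow> bool" where
  "smooth_on g U \<longleftrightarrow> (\<forall>k. Ck_on k g U)"

text \<open>
  A smooth complex \<open>k\<close>-form on the open set \<open>U\<close> assigns to each point of \<open>U\<close> an alternating
  real-multilinear complex-valued function of \<open>k\<close> tangent vectors. It is extended by 0 to points
  outside \<open>U\<close> and to lists of length other than \<open>k\<close>.
\<close>

definition diff_forms ::
  "nat \<Rightarrow> 'v::euclidean_space set \<Rightarrow> ('v \<Rightarrow> 'v list \<Rightarrow> complex) set" where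
  "diff_forms k U = {\<alpha>.
     (\<forall>x vs. x \<notin> U \<or> length vs \<noteq> k \<longrightarrow> \<alpha> x vs = 0) \<and>
     (\<forall>x\<in>U. \<forall>vs. length vs = k \<longrightarrow>
        (\<forall>i<k. linear (\<lambda>v. \<alpha> x (vs[i := v]))) \<and>
        (\<forall>i j. i < j \<and> j < k \<and> vs ! i = vs ! j \<longrightarrow> \<alpha> x vs = 0)) \<and>
     (\<forall>vs. length vs = k \<longrightarrow> smooth_on (\<lambda>x. \<alpha> x vs) U)}"

text \<open>
  The exterior derivative of a \<open>k\<close>-form, evaluated on constant vector fields. The normalisation
  (no factor \<open>1/(k+1)\<close>) goes with the determinant convention in \<open>wedge_dz\<close> below.
\<close>

definition ext_deriv ::
  "nat \<Rightarrow> 'v::euclidean_space set \<Rightarrow> ('v \<Rightarrow> 'v list \<Rightarrow> complex) \<Rightarrow> 'v \<Rightarrow> 'v list \<Rightarrow> complex" where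
  "ext_deriv k U \<alpha> x vs =
     (if x \<in> U \<and> length vs = Suc k then
        (\<Sum>i\<le>k. (- 1) ^ i *
           frechet_derivative (\<lambda>y. \<alpha> y (take i vs @ drop (Suc i) vs)) (at x) (vs ! i))
      else 0)"

definition closed_forms ::
  "nat \<Rightarrow> 'v::euclidean_space set \<Rightarrow> ('v \<Rightarrow> 'v list \<Rightarrow> complex) set" where
  "closed_forms k U = {\<alpha> \<in> diff_forms k U. ext_deriv k U \<alpha> = 0}"

definition exact_forms ::
  "nat \<Rightarrow> 'v::euclidean_space set \<Rightarrow> ('v \<Rightarrow> 'v list \<Rightarrow> complex) set" where
  "exact_forms k U = (case k of 0 \<Rightarrow> {0} | Suc r \<Rightarrow> ext_deriv r U ` diff_forms r U)"


section \<open>Evaluation of functionals on algebra-valued forms\<close>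

text \<open>\<open>wedge_dz [i\<^sub>0, \<dots>, i\<^sub>k] = dz\<^bsub>i\<^sub>0\<^esub> \<and> \<dots> \<and> dz\<^bsub>i\<^sub>k\<^esub>\<close>, as a determinant.\<close>

definition wedge_dz :: "'n::finite list \<Rightarrow> (complex^'n) list \<Rightarrow> complex" where
  "wedge_dz I vs =
     (\<Sum>\<pi> | \<pi> permutes {..<length I}.
        of_int (sign \<pi>) * (\<Prod>a<length I. (vs ! \<pi> a) $ (I ! a)))"

definition eval_on_forms ::
  "('b list \<Rightarrow> complex) \<Rightarrow> ('n::finite \<Rightarrow> complex^'n \<Rightarrow> 'b) list \<Rightarrow>
     complex^'n \<Rightarrow> (complex^'n) list \<Rightarrow> complex" where
  "eval_on_forms F \<eta>s z vs =
     (\<Sum>I | length I = length \<eta>s. F (map2 (\<lambda>\<eta> i. \<eta> i z) \<eta>s I) * wedge_dz I vs)"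

definition kappa ::
  "(complex^'n \<Rightarrow> 'b::topological_complex_algebra) \<Rightarrow> nat \<Rightarrow> ('b list \<Rightarrow> complex) \<Rightarrow>
     complex^'n \<Rightarrow> (complex^'n) list \<Rightarrow> complex" where
  "kappa f p \<phi> z vs =
     (if z \<in> resolvent_set f \<and> length vs = Suc p
      then eval_on_forms \<phi> (replicate (Suc p) (omega f)) z vs else 0)"

end

theory Submission
  imports Defs "HOL-Complex_Analysis.Cauchy_Integral_Formula"
begin

text \<open>
  Write \<open>\<Omega>(v)\<close> for the value of the form \<open>\<omega> = f\<inverse> df\<close> on a tangent vector \<open>v\<close>. For an \<open>m\<close>-linear
  functional \<open>\<phi>\<close>, expanding \<open>\<phi>(\<omega>, \<dots>, \<omega>)\<close> by multilinearity shows that it is the alternating sum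
  \<open>\<Sum>\<pi>. sgn \<pi> \<cdot> \<phi>(\<Omega>(v\<^bsub>\<pi> 0\<^esub>), \<dots>, \<Omega>(v\<^bsub>\<pi> (m-1)\<^esub>))\<close> (\<open>kappa_eq_alt_sum\<close>). Everything then follows
  from one identity between alternating sums (\<open>kappa_hochschild_b\<close>): for a cyclic cochain \<open>\<phi>\<close> of degree \<open>p\<close>,
  \<open>(p + 2) d\<kappa>(\<phi>) = - (p + 1) \<kappa>(b\<phi>)\<close>.
  Hence \<open>\<kappa>\<close> sends cyclic cocycles to closed forms and coboundaries of cyclic cochains to exact forms,
  and being linear it descends to the quotients (\<open>quotient_hom_induced\<close>).

  The identity has an analytic and a combinatorial half. Analytically, \<open>d\<omega> = - \<omega> \<and> \<omega>\<close>
  (\<open>omega_structure_equation\<close>). This is read off from \<open>f \<omega>\<^sub>i = \<partial>\<^sub>i f\<close>: differentiating this product avoids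
  the derivative of \<open>f\<inverse>\<close>, and it remains to see that the mixed partial derivatives of \<open>f\<close> agree. In a
  topological vector space that is not locally convex there is no mean value theorem to prove this in the
  algebra, but the equation is only ever inserted into one argument of a continuous multilinear functional. So it
  is enough to know it after composition with a continuous linear functional \<open>\<psi>\<close>, and \<open>\<psi> \<circ> f\<close> is a
  scalar function that is continuous and holomorphic in each variable; for those the Cauchy estimates give
  smoothness and symmetry of second derivatives (\<open>partial_deriv_commute\<close>).

  Combinatorially, the Leibniz rule turns \<open>d\<kappa>(\<phi>)\<close> into an alternating sum over the permutations of one
  more vector (\<open>alt_sum_Suc\<close>), in which the derivative of \<open>\<omega>\<close> sits in the \<open>k\<close>-th argument. The structure equation
  replaces it by the product of two neighbouring factors, and the \<open>k\<close>-th term becomes minus the alternation of the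
  \<open>k\<close>-th summand of \<open>b\<phi>\<close>. Cyclicity makes all these alternations equal to the one for \<open>k = 0\<close>
  (\<open>alt_sum_merged\<close>). There are \<open>p + 1\<close> of them in \<open>d\<kappa>(\<phi>)\<close>, whereas \<open>b\<phi>\<close> has one more summand, the
  wrap-around term, which contributes the same amount; this accounts for the two coefficients.
\<close>

section \<open>Separately holomorphic scalar functions of several variables\<close>

text \<open>
  These functions are holomorphic by Osgood's lemma; only the consequences for partial derivatives and
  real smoothness are developed.
\<close>

definition sep_holo :: "(complex^'n \<Rightarrow> complex) \<Rightarrow> (complex^'n) set \<Rightarrow> bool" where
  "sep_holo g U \<longleftrightarrow> continuous_on U g \<and>
     (\<forall>z\<in>U. \<forall>i. (\<lambda>t. g (z + axis i t)) field_differentiable (at 0))"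

definition partial_deriv :: "'n \<Rightarrow> (complex^'n \<Rightarrow> complex) \<Rightarrow> complex^'n \<Rightarrow> complex" where
  "partial_deriv i g z = deriv (\<lambda>t. g (z + axis i t)) 0"

lemma axis_add: "axis i (s + t) = axis i s + axis i (t::complex)"
  by (simp add: vec_eq_iff axis_def)

lemma axis_zero: "axis i (0::complex) = 0"
  by (simp add: vec_eq_iff axis_def)

lemma norm_axis_complex: "norm (axis i (t::complex) :: complex^'n) = norm t"
proof -
  have "L2_set (\<lambda>j. norm ((axis i t :: complex^'n) $ j)) UNIV = L2_set (\<lambda>j. if j = i then norm t else 0) UNIV"
    by (rule L2_set_cong) (auto simp: axis_def)
  also have "\<dots> = norm t"
    by (simp add: L2_set_def if_distrib[of "\<lambda>x. x ^ 2"] sum.delta cong: if_cong)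
  finally show ?thesis by (simp add: norm_vec_def)
qed

lemma continuous_on_axis [continuous_intros]:
  "continuous_on S h \<Longrightarrow> continuous_on S (\<lambda>s. axis i (h s :: complex) :: complex^'n)"
proof (rule continuous_on_compose2[of UNIV "\<lambda>t. axis i t"])
  show "continuous_on UNIV (\<lambda>t. axis i t :: complex^'n)"
    unfolding continuous_on_iff dist_norm
    by (metis (no_types, opaque_lifting) add_diff_cancel axis_add diff_add_cancel norm_axis_complex)
qed auto

lemma sep_holo_slice:
  assumes "sep_holo g U" "z + axis i s \<in> U"
  shows "((\<lambda>t. g (z + axis i t)) has_field_derivative partial_deriv i g (z + axis i s)) (at s)"
proof -
  have "((\<lambda>t. g ((z + axis i s) + axis i t)) has_field_derivative partial_deriv i g (z + axis i s)) (at 0)"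
    using assms unfolding sep_holo_def partial_deriv_def by (simp add: DERIV_deriv_iff_field_differentiable)
  then have "((\<lambda>t. g (z + axis i (s + t))) has_field_derivative partial_deriv i g (z + axis i s)) (at 0)"
    by (simp add: axis_add add.assoc)
  then show ?thesis
    using DERIV_at_within_shift[of "\<lambda>t. g (z + axis i t)" "partial_deriv i g (z + axis i s)" s 0 UNIV] by simp
qed

lemma sep_holo_partial_deriv_D:
  assumes "sep_holo g U" "z \<in> U"
  shows "((\<lambda>t. g (z + axis i t)) has_field_derivative partial_deriv i g z) (at 0)"
  using sep_holo_slice[of g U z i 0] assms by (simp add: axis_zero)

lemma partial_deriv_eqI: "((\<lambda>t. g (z + axis i t)) has_field_derivative D) (at 0) \<Longrightarrow> partial_deriv i g z = D"
  by (simp add: partial_deriv_def DERIV_imp_deriv)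

text \<open>
  The Cauchy inequality on discs of radius \<open>R/4\<close> bounds the second derivative on the disc of radius
  \<open>R/2\<close> by \<open>2 M / (R/4)\<^sup>2\<close>, and Taylor's formula does the rest. What matters is that the bound depends on \<open>f\<close> only
  through \<open>M\<close> and \<open>R\<close>, so that it is uniform in parameters.
\<close>

lemma difference_quotient_bound:
  assumes hol: "f holomorphic_on ball 0 R" and R: "R > 0"
    and M: "\<And>x. x \<in> ball 0 R \<Longrightarrow> norm (f x) \<le> M" and t: "norm t \<le> R / 2" "t \<noteq> 0"
  shows "norm ((f t - f 0) / t - deriv f 0) \<le> 32 * M / R\<^sup>2 * norm t"
proof -
  define F where "F k = (deriv ^^ k) f" for k :: nat
  have F: "(F k has_field_derivative F (Suc k) x) (at x)" if "x \<in> ball 0 R" for k x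
    using holomorphic_derivI[OF holomorphic_higher_deriv[OF hol open_ball, of k] open_ball that]
    by (simp add: F_def)
  have B: "norm (F (Suc 1) x) \<le> 32 * M / R\<^sup>2" if "x \<in> cball 0 (R/2)" for x
  proof -
    have sub: "cball x (R/4) \<subseteq> ball 0 R"
    proof
      fix y assume "y \<in> cball x (R/4)"
      then have "norm y \<le> R/2 + R/4"
        using that norm_triangle_ineq[of x "y - x"] by (simp add: dist_norm norm_minus_commute)
      then show "y \<in> ball 0 R" using R by simp
    qed
    have "norm ((deriv ^^ 2) f x) \<le> fact 2 * M / (R/4) ^ 2"
    proof (rule Cauchy_inequality)
      show "f holomorphic_on ball x (R/4)"
        by (rule holomorphic_on_subset[OF hol]) (use sub ball_subset_cball in blast)
      show "continuous_on (cball x (R/4)) f"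
        using holomorphic_on_imp_continuous_on[OF hol] continuous_on_subset sub by blast
      show "norm (f y) \<le> M" if "norm (x - y) = R/4" for y
        by (rule M) (use sub that in \<open>auto simp: subset_iff dist_norm\<close>)
    qed (use R in auto)
    then show ?thesis by (simp add: F_def power2_eq_square numeral_2_eq_2)
  qed
  have "norm (F 0 t - (\<Sum>i\<le>1. F i 0 * (t - 0) ^ i / fact i))
      \<le> 32 * M / R\<^sup>2 * norm (t - 0) ^ Suc 1 / fact 1"
  proof (rule complex_Taylor[where S = "cball 0 (R/2)"])
    show "(F i has_field_derivative F (Suc i) x) (at x within cball 0 (R/2))"
      if "x \<in> cball 0 (R/2)" for i x
      by (rule has_field_derivative_at_within, rule F) (use that R in auto)
  qed (use B t R in auto)
  then have "norm (f t - f 0 - deriv f 0 * t) \<le> 32 * M / R\<^sup>2 * norm t * norm t"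
    by (simp add: F_def power2_eq_square algebra_simps)
  moreover have "norm ((f t - f 0) / t - deriv f 0) = norm (f t - f 0 - deriv f 0 * t) / norm t"
    using t by (simp add: norm_divide[symmetric] field_simps)
  ultimately show ?thesis using t by (simp add: divide_le_eq)
qed

text \<open>
  Continuity bounds \<open>g\<close> on a compact ball, so the preceding estimate applies to all slices at once. Uniform
  convergence is the vehicle that carries continuity and holomorphy from \<open>g\<close> to its partial
  derivatives.
\<close>

lemma difference_quotients_uniform:
  fixes g :: "complex^'n \<Rightarrow> complex"
  assumes U: "open U" and g: "sep_holo g U" and z0: "z0 \<in> U"
  obtains \<rho> t where "\<rho> > 0" "ball z0 (2 * \<rho>) \<subseteq> U" "\<And>n. t n \<noteq> 0" "\<And>n. norm (t n) < \<rho>" "t \<longlonglongrightarrow> 0"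
    "uniform_limit (ball z0 \<rho>) (\<lambda>n z. (g (z + axis i (t n)) - g z) / t n) (partial_deriv i g) sequentially"
proof -
  obtain e where e: "e > 0" "cball z0 e \<subseteq> U"
    using U z0 open_contains_cball by blast
  define \<rho> where "\<rho> = e / 2"
  have \<rho>: "\<rho> > 0" "cball z0 (2*\<rho>) \<subseteq> U" using e by (auto simp: \<rho>_def)
  \<comment> \<open>Any null sequence of nonzero numbers below \<open>\<rho> / 2\<close> would do.\<close>
  define t where "t n = complex_of_real (\<rho> / (2 * real (Suc n)))" for n
  have t0: "t n \<noteq> 0" for n using \<rho> unfolding t_def of_real_eq_0_iff by simp
  have nt: "norm (t n) = \<rho> / (2 * real (Suc n))" for n
    using \<rho> unfolding t_def norm_of_real by simp
  have nt2: "norm (t n) \<le> \<rho> / 2" for n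
    using \<rho> unfolding nt by (simp add: field_simps)
  have tlim: "t \<longlonglongrightarrow> 0"
  proof -
    have "(\<lambda>n. \<rho> / 2 * inverse (real (Suc n))) \<longlonglongrightarrow> \<rho> / 2 * 0"
      by (intro tendsto_intros LIMSEQ_inverse_real_of_nat)
    then have "(\<lambda>n. norm (t n)) \<longlonglongrightarrow> 0" by (simp add: nt field_simps)
    then show ?thesis by (rule tendsto_norm_zero_cancel)
  qed
  have "bounded (g ` cball z0 (2*\<rho>))"
    by (rule compact_imp_bounded, rule compact_continuous_image)
       (use g \<rho> in \<open>auto simp: sep_holo_def intro: continuous_on_subset\<close>)
  then obtain M where M: "\<And>w. w \<in> cball z0 (2*\<rho>) \<Longrightarrow> norm (g w) \<le> M"
    unfolding bounded_iff by blast
  have est: "norm ((g (z + axis i (t n)) - g z) / t n - partial_deriv i g z) \<le> 32 * M / \<rho>\<^sup>2 * norm (t n)"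
    if z: "z \<in> ball z0 \<rho>" for z n
  proof -
    have in_cball: "z + axis i s \<in> cball z0 (2*\<rho>)" if "s \<in> ball 0 \<rho>" for s
    proof -
      have "dist z0 (z + axis i s) \<le> dist z0 z + norm s"
        using dist_triangle[of z0 "z + axis i s" z] by (simp add: dist_norm norm_axis_complex)
      then show ?thesis using that z by simp
    qed
    have "norm ((g (z + axis i (t n)) - g (z + axis i 0)) / t n - deriv (\<lambda>s. g (z + axis i s)) 0)
       \<le> 32 * M / \<rho>\<^sup>2 * norm (t n)"
    proof (rule difference_quotient_bound)
      show "(\<lambda>s. g (z + axis i s)) holomorphic_on ball 0 \<rho>"
        unfolding holomorphic_on_open[OF open_ball]
        using sep_holo_slice[OF g] in_cball \<rho>(2) by blast
    qed (use \<rho> M in_cball nt2 t0 in auto)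
    then show ?thesis by (simp add: axis_zero partial_deriv_def)
  qed
  have ul: "uniform_limit (ball z0 \<rho>) (\<lambda>n z. (g (z + axis i (t n)) - g z) / t n) (partial_deriv i g) sequentially"
  proof (rule uniform_limitI)
    fix d :: real assume d: "d > 0"
    have "(\<lambda>n. 32 * M / \<rho>\<^sup>2 * norm (t n)) \<longlonglongrightarrow> 32 * M / \<rho>\<^sup>2 * norm (0::complex)"
      by (intro tendsto_intros tlim)
    then have "\<forall>\<^sub>F n in sequentially. 32 * M / \<rho>\<^sup>2 * norm (t n) < d"
      using d by (simp add: order_tendsto_iff)
    then show "\<forall>\<^sub>F n in sequentially. \<forall>z\<in>ball z0 \<rho>. dist ((g (z + axis i (t n)) - g z) / t n) (partial_deriv i g z) < d"
    proof eventually_elim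
      case (elim n)
      then show ?case using est[of _ n] le_less_trans unfolding dist_norm by blast
    qed
  qed
  show ?thesis
  proof (rule that[OF \<rho>(1) _ t0 _ tlim ul])
    show "ball z0 (2*\<rho>) \<subseteq> U" using \<rho> ball_subset_cball by blast
    show "norm (t n) < \<rho>" for n using nt2[of n] \<rho> by linarith
  qed
qed

text \<open>
  Differentiating the locally uniform limit of the difference quotients in direction \<open>i\<close> along direction \<open>j\<close> may be done
  term by term. The derivatives of the quotients are difference quotients of the \<open>j\<close>-th partial derivative, so
  the limit \<open>D\<close> is the mixed derivative taken in either order.
\<close>

lemma partial_deriv_slice_derivative:
  fixes g :: "complex^'n \<Rightarrow> complex"
  assumes U: "open U" and g: "sep_holo g U" and z: "z \<in> U"
  obtains D t where "\<And>n. t n \<noteq> 0" "t \<longlonglongrightarrow> 0"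
    "((\<lambda>s. partial_deriv i g (z + axis j s)) has_field_derivative D) (at 0)"
    "(\<lambda>n. (partial_deriv j g (z + axis i (t n)) - partial_deriv j g z) / t n) \<longlonglongrightarrow> D"
proof -
  obtain \<rho> t where \<rho>: "\<rho> > 0" "ball z (2 * \<rho>) \<subseteq> U" and t0: "\<And>n. t n \<noteq> 0"
    and nt: "\<And>n. norm (t n) < \<rho>" and tlim: "t \<longlonglongrightarrow> 0"
    and ul: "uniform_limit (ball z \<rho>) (\<lambda>n z. (g (z + axis i (t n)) - g z) / t n) (partial_deriv i g) sequentially"
    by (rule difference_quotients_uniform[OF U g z, of i]) (rule that; assumption)
  define S where "S = ball (0::complex) \<rho>"
  have openS: "open S" by (simp add: S_def)
  have inb: "z + axis j s \<in> ball z \<rho>" if "s \<in> S" for s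
    using that by (simp add: S_def dist_norm norm_axis_complex)
  have inU: "z + axis j s \<in> U" if "s \<in> S" for s
    using inb[OF that] \<rho> by (auto simp: subset_iff)
  have inU2: "(z + axis i (t n)) + axis j s \<in> U" if "s \<in> S" for s n
  proof -
    have "norm (axis i (t n) + axis j s) < \<rho> + \<rho>"
      using norm_triangle_ineq[of "axis i (t n)" "axis j s"] nt[of n] that
      by (simp add: S_def norm_axis_complex)
    then have "dist ((z + axis i (t n)) + axis j s) z < 2 * \<rho>"
      by (simp add: dist_norm add.assoc)
    then have "(z + axis i (t n)) + axis j s \<in> ball z (2*\<rho>)"
      by (simp add: dist_commute)
    then show ?thesis using \<rho> by blast
  qed
  have "\<exists>g'. \<forall>s\<in>S. ((\<lambda>s. partial_deriv i g (z + axis j s)) has_field_derivative g' s) (at s) \<and>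
      ((\<lambda>n. (partial_deriv j g ((z + axis i (t n)) + axis j s) - partial_deriv j g (z + axis j s)) / t n) \<longlonglongrightarrow> g' s)"
  proof (rule has_complex_derivative_uniform_sequence
      [where f = "\<lambda>n s. (g ((z + axis i (t n)) + axis j s) - g (z + axis j s)) / t n"
         and f' = "\<lambda>n s. (partial_deriv j g ((z + axis i (t n)) + axis j s) - partial_deriv j g (z + axis j s)) / t n"])
    show "((\<lambda>s. (g ((z + axis i (t n)) + axis j s) - g (z + axis j s)) / t n) has_field_derivative
       (partial_deriv j g ((z + axis i (t n)) + axis j s) - partial_deriv j g (z + axis j s)) / t n) (at s)"
      if "s \<in> S" for n s
      by (rule DERIV_cdivide[OF DERIV_diff[OF sep_holo_slice[OF g inU2[OF that]]
            sep_holo_slice[OF g inU[OF that]]]])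
    show "\<exists>d>0. cball x d \<subseteq> S \<and> uniform_limit (cball x d)
        (\<lambda>n s. (g ((z + axis i (t n)) + axis j s) - g (z + axis j s)) / t n)
        (\<lambda>s. partial_deriv i g (z + axis j s)) sequentially" if x: "x \<in> S" for x
    proof -
      obtain d where d: "d > 0" "cball x d \<subseteq> S"
        using open_contains_cball_eq[OF openS] x by blast
      have "uniform_limit (cball x d)
        (\<lambda>n s. (g ((z + axis j s) + axis i (t n)) - g (z + axis j s)) / t n)
        (\<lambda>s. partial_deriv i g (z + axis j s)) sequentially"
        by (rule uniform_limit_compose'[OF ul, where h = "\<lambda>s. z + axis j s"]) (use d inb in blast)
      moreover have "z + axis j s + axis i (t n) = z + axis i (t n) + axis j s" for s n
        by (simp add: add_ac)
      ultimately have "uniform_limit (cball x d)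
        (\<lambda>n s. (g ((z + axis i (t n)) + axis j s) - g (z + axis j s)) / t n)
        (\<lambda>s. partial_deriv i g (z + axis j s)) sequentially"
        by simp
      then show ?thesis using d by blast
    qed
  qed (rule openS)
  then obtain g' where "\<And>s. s \<in> S \<Longrightarrow> ((\<lambda>s. partial_deriv i g (z + axis j s)) has_field_derivative g' s) (at s) \<and>
      ((\<lambda>n. (partial_deriv j g ((z + axis i (t n)) + axis j s) - partial_deriv j g (z + axis j s)) / t n) \<longlonglongrightarrow> g' s)"
    by blast
  from this[of 0] have "((\<lambda>s. partial_deriv i g (z + axis j s)) has_field_derivative g' 0) (at 0)"
     "(\<lambda>n. (partial_deriv j g (z + axis i (t n)) - partial_deriv j g z) / t n) \<longlonglongrightarrow> g' 0"
    using \<rho> by (auto simp: S_def axis_zero)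
  then show ?thesis using that t0 tlim by blast
qed

lemma sep_holo_partial_deriv:
  fixes g :: "complex^'n \<Rightarrow> complex"
  assumes U: "open U" and g: "sep_holo g U"
  shows "sep_holo (partial_deriv i g) U"
  unfolding sep_holo_def
proof (intro conjI ballI allI)
  show "continuous_on U (partial_deriv i g)"
    unfolding continuous_on_eq_continuous_at[OF U]
  proof
    fix z assume z: "z \<in> U"
    obtain \<rho> t where \<rho>: "\<rho> > 0" "ball z (2 * \<rho>) \<subseteq> U" and nt: "\<And>n. norm (t n) < \<rho>"
      and ul: "uniform_limit (ball z \<rho>) (\<lambda>n z. (g (z + axis i (t n)) - g z) / t n) (partial_deriv i g) sequentially"
      and t0: "\<And>n. t n \<noteq> 0"
      by (rule difference_quotients_uniform[OF U g z, of i]) (rule that; assumption)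
    have gc: "continuous_on U g" using g by (simp add: sep_holo_def)
    have "continuous_on (ball z \<rho>) (partial_deriv i g)"
    proof (rule uniform_limit_theorem[OF _ ul])
      have "continuous_on (ball z \<rho>) (\<lambda>z. (g (z + axis i (t n)) - g z) / t n)" for n
      proof (intro continuous_intros continuous_on_compose2[OF gc])
        have sub: "w + axis i (t n) \<in> ball z (2*\<rho>)" if "w \<in> ball z \<rho>" for w
          using dist_triangle[of z "w + axis i (t n)" w] that nt[of n]
          by (simp add: dist_norm norm_axis_complex)
        then show "(\<lambda>z. z + axis i (t n)) ` ball z \<rho> \<subseteq> U" using \<rho> by blast
        show "(\<lambda>x. x) ` ball z \<rho> \<subseteq> U" using \<rho> by (auto simp: subset_iff)
      qed (use t0 in auto)
      then show "\<forall>\<^sub>F n in sequentially. continuous_on (ball z \<rho>) (\<lambda>z. (g (z + axis i (t n)) - g z) / t n)"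
        by simp
    qed simp
    then show "isCont (partial_deriv i g) z"
      using \<rho> by (simp add: continuous_on_eq_continuous_at)
  qed
next
  fix z j assume z: "z \<in> U"
  show "(\<lambda>t. partial_deriv i g (z + axis j t)) field_differentiable at 0"
    unfolding field_differentiable_def by (rule partial_deriv_slice_derivative[OF U g z, of i j]) (rule exI)
qed

lemma partial_deriv_commute:
  fixes g :: "complex^'n \<Rightarrow> complex"
  assumes U: "open U" and g: "sep_holo g U" and z: "z \<in> U"
  shows "partial_deriv j (partial_deriv i g) z = partial_deriv i (partial_deriv j g) z"
proof -
  obtain D t where t: "\<And>n. t n \<noteq> 0" "t \<longlonglongrightarrow> 0"
    and D: "((\<lambda>s. partial_deriv i g (z + axis j s)) has_field_derivative D) (at 0)"
    and lim: "(\<lambda>n. (partial_deriv j g (z + axis i (t n)) - partial_deriv j g z) / t n) \<longlonglongrightarrow> D"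
    by (rule partial_deriv_slice_derivative[OF U g z, of i j]) (rule that; assumption)
  have "((\<lambda>s. partial_deriv j g (z + axis i s)) has_field_derivative partial_deriv i (partial_deriv j g) z) (at 0)"
    by (rule sep_holo_partial_deriv_D[OF sep_holo_partial_deriv[OF U g] z])
  then have "((\<lambda>h. (partial_deriv j g (z + axis i h) - partial_deriv j g z) / h) \<longlongrightarrow> partial_deriv i (partial_deriv j g) z) (at 0)"
    by (simp add: DERIV_def axis_zero)
  then have "(\<lambda>n. (partial_deriv j g (z + axis i (t n)) - partial_deriv j g z) / t n) \<longlonglongrightarrow> partial_deriv i (partial_deriv j g) z"
    by (rule filterlim_compose) (use t in \<open>auto simp: filterlim_at\<close>)
  then have "partial_deriv i (partial_deriv j g) z = D" using lim LIMSEQ_unique by blast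
  then show ?thesis using partial_deriv_eqI[OF D] by simp
qed

text \<open>
  The increment from \<open>z\<close> to \<open>z + h\<close> is collected one coordinate at a time; in each step the complex mean
  value inequality and the continuity of the partial derivative give a remainder of order \<open>o(h)\<close>.
\<close>

lemma sep_holo_has_derivative:
  fixes g :: "complex^'n \<Rightarrow> complex"
  assumes U: "open U" and g: "sep_holo g U" and z: "z \<in> U"
  shows "(g has_derivative (\<lambda>v. \<Sum>i\<in>UNIV. v $ i * partial_deriv i g z)) (at z)"
proof -
  define P where "P S h = (\<chi> i. if i \<in> S then h $ i else (0 :: complex))" for S :: "'n set" and h :: "complex^'n"
  have normP: "norm (P S h) \<le> norm h" for S h
    unfolding norm_vec_def by (rule L2_set_mono) (auto simp: P_def)
  have "((\<lambda>h. g (z + P S h)) has_derivative (\<lambda>v. \<Sum>i\<in>S. v $ i * partial_deriv i g z)) (at 0)" for S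
  proof (induction S rule: finite_induct[OF finite])
    case 1
    then show ?case by (simp add: P_def zero_vec_def[symmetric])
  next
    case (2 i S)
    define E where "E h = g (z + P S h + axis i (h $ i)) - g (z + P S h) - h $ i * partial_deriv i g z" for h
    have P_insert: "z + P (insert i S) h = z + P S h + axis i (h $ i)" for h
      using 2 by (auto simp: P_def vec_eq_iff axis_def)
    have E0: "E 0 = 0" by (simp add: E_def axis_zero)
    have "(E has_derivative (\<lambda>v. 0)) (at 0)"
      unfolding has_derivative_at_alt
    proof (intro conjI allI impI)
      fix e :: real assume e: "e > 0"
      have "isCont (partial_deriv i g) z"
        using sep_holo_partial_deriv[OF U g, of i] z U by (simp add: sep_holo_def continuous_on_eq_continuous_at)
      then obtain d1 where d1: "d1 > 0" "\<And>w. dist w z < d1 \<Longrightarrow> dist (partial_deriv i g w) (partial_deriv i g z) < e"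
        using e unfolding continuous_at_eps_delta by blast
      obtain d2 where d2: "d2 > 0" "ball z d2 \<subseteq> U" using U z open_contains_ball by blast
      define d where "d = min d1 d2 / 2"
      have d: "d > 0" "2 * d \<le> d1" "2 * d \<le> d2" using d1 d2 by (auto simp: d_def)
      have "norm (E h) \<le> e * norm h" if h: "norm h < d" for h
      proof -
        have near: "dist (z + P S h + axis i s) z < 2 * d" if "s \<in> closed_segment 0 (h $ i)" for s
        proof -
          have "norm s \<le> norm (h $ i)" using segment_bound1[OF that] by simp
          also have "\<dots> \<le> norm h" by (rule Finite_Cartesian_Product.norm_nth_le)
          finally have "norm s \<le> norm h" .
          then have "norm (P S h + axis i s) \<le> norm h + norm h"
            using norm_triangle_ineq[of "P S h" "axis i s"] normP[of S h] by (simp add: norm_axis_complex)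
          then show ?thesis using h by (simp add: dist_norm add.assoc)
        qed
        define k where "k s = g (z + P S h + axis i s) - s * partial_deriv i g z" for s
        have "norm (k (h $ i) - k 0) \<le> e * norm (h $ i - 0)"
        proof (rule field_differentiable_bound[where S = "closed_segment 0 (h $ i)"
              and f' = "\<lambda>s. partial_deriv i g (z + P S h + axis i s) - partial_deriv i g z"])
          fix s assume s: "s \<in> closed_segment 0 (h $ i)"
          have "z + P S h + axis i s \<in> U"
            using near[OF s] d d2 by (auto simp: subset_iff dist_commute)
          from sep_holo_slice[OF g this]
          have "((\<lambda>s. g (z + P S h + axis i s) - s * partial_deriv i g z) has_field_derivative
              partial_deriv i g (z + P S h + axis i s) - 1 * partial_deriv i g z) (at s)"
            by (intro DERIV_diff DERIV_cmult_right DERIV_ident)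
          then show "(k has_field_derivative partial_deriv i g (z + P S h + axis i s) - partial_deriv i g z)
              (at s within closed_segment 0 (h $ i))"
            unfolding k_def by (simp add: has_field_derivative_at_within)
          show "norm (partial_deriv i g (z + P S h + axis i s) - partial_deriv i g z) \<le> e"
            using d1(2)[of "z + P S h + axis i s"] near[OF s] d by (simp add: dist_norm)
        qed auto
        also have "e * norm (h $ i - 0) \<le> e * norm h"
          using e Finite_Cartesian_Product.norm_nth_le[of h i] by simp
        finally show ?thesis by (simp add: k_def E_def axis_zero algebra_simps)
      qed
      then show "\<exists>d>0. \<forall>y. norm (y - 0) < d \<longrightarrow> norm (E y - E 0 - 0) \<le> e * norm (y - 0)"
        using d(1) E0 by auto
    qed (rule bounded_linear_zero)
    moreover have "((\<lambda>h. h $ i * partial_deriv i g z) has_derivative (\<lambda>v. v $ i * partial_deriv i g z)) (at 0)"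
      by (intro has_derivative_mult_left bounded_linear_imp_has_derivative bounded_linear_vec_nth)
    ultimately have "((\<lambda>h. g (z + P S h) + h $ i * partial_deriv i g z + E h) has_derivative
        (\<lambda>v. (\<Sum>i\<in>S. v $ i * partial_deriv i g z) + v $ i * partial_deriv i g z + 0)) (at 0)"
      by (intro has_derivative_add 2)
    then show ?case
      using 2 unfolding P_insert by (simp add: E_def algebra_simps)
  qed
  from this[of UNIV] have "((\<lambda>h. g (z + h)) has_derivative (\<lambda>v. \<Sum>i\<in>UNIV. v $ i * partial_deriv i g z)) (at 0)"
    by (simp add: P_def)
  then show ?thesis
    by (simp add: has_derivative_at)
qed

lemma sep_holo_frechet_derivative:
  fixes g :: "complex^'n \<Rightarrow> complex"
  assumes "open U" "sep_holo g U" "z \<in> U"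
  shows "frechet_derivative g (at z) v = (\<Sum>i\<in>UNIV. v $ i * partial_deriv i g z)"
  using frechet_derivative_at[OF sep_holo_has_derivative[OF assms], symmetric] by simp

lemma sep_holo_add:
  assumes "sep_holo g U" "sep_holo h U"
  shows "sep_holo (\<lambda>z. g z + h z) U"
  using assms unfolding sep_holo_def by (auto intro!: continuous_intros derivative_intros)

lemma sep_holo_cmult:
  assumes "sep_holo g U"
  shows "sep_holo (\<lambda>z. c * g z) U"
  using assms unfolding sep_holo_def by (auto intro!: continuous_intros derivative_intros)

lemma sep_holo_sum:
  "(\<And>x. x \<in> X \<Longrightarrow> sep_holo (g x) U) \<Longrightarrow> sep_holo (\<lambda>z. \<Sum>x\<in>X. g x z) U"
proof (induction X rule: infinite_finite_induct)
  case (insert x X)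
  then show ?case using sep_holo_add[of "g x" U "\<lambda>z. \<Sum>x\<in>X. g x z"] by simp
qed (auto simp: sep_holo_def)

lemma Ck_on_cong:
  assumes "open U" "\<And>x. x \<in> U \<Longrightarrow> g x = h x"
  shows "Ck_on k g U \<longleftrightarrow> Ck_on k h U"
proof -
  have imp: "Ck_on k h U" if "Ck_on k g U" "\<And>x. x \<in> U \<Longrightarrow> g x = h x" for g h :: "'a \<Rightarrow> complex"
    using that
  proof (induction k arbitrary: g h)
    case 0
    then show ?case by (simp cong: continuous_on_cong)
  next
    case (Suc k)
    have D: "(h has_derivative frechet_derivative g (at x)) (at x)" if "x \<in> U" for x
    proof (rule has_derivative_transform_within_open[OF _ assms(1) that])
      show "(g has_derivative frechet_derivative g (at x)) (at x)"
        using Suc.prems(1) that by (simp add: frechet_derivative_works)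
    qed (use Suc.prems in auto)
    show ?case unfolding Ck_on.simps
    proof (intro conjI ballI allI)
      show "h differentiable at x" if "x \<in> U" for x
        using D[OF that] by (auto simp: differentiable_def)
      show "Ck_on k (\<lambda>x. frechet_derivative h (at x) v) U" for v
      proof (rule Suc.IH[of "\<lambda>x. frechet_derivative g (at x) v"])
        show "Ck_on k (\<lambda>x. frechet_derivative g (at x) v) U" using Suc.prems by simp
        show "frechet_derivative g (at x) v = frechet_derivative h (at x) v" if "x \<in> U" for x
          using frechet_derivative_at[OF D[OF that], symmetric] by simp
      qed
    qed
  qed
  show ?thesis using imp[of g h] imp[of h g] assms(2) by auto
qed

lemma smooth_on_cong:
  "open U \<Longrightarrow> (\<And>x. x \<in> U \<Longrightarrow> g x = h x) \<Longrightarrow> smooth_on g U \<longleftrightarrow> smooth_on h U"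
  unfolding smooth_on_def using Ck_on_cong[of U g h] by simp

lemma Ck_on_add_cmult:
  assumes "open U"
  shows "Ck_on k g U \<Longrightarrow> Ck_on k h U \<Longrightarrow> Ck_on k (\<lambda>x. g x + c * h x) U"
proof (induction k arbitrary: g h)
  case 0
  then show ?case by (auto intro!: continuous_intros)
next
  case (Suc k)
  have D: "((\<lambda>x. g x + c * h x) has_derivative
      (\<lambda>v. frechet_derivative g (at x) v + c * frechet_derivative h (at x) v)) (at x)" if "x \<in> U" for x
    using Suc.prems that
    by (intro has_derivative_add has_derivative_mult_right) (auto simp: frechet_derivative_works)
  show ?case unfolding Ck_on.simps
  proof (intro conjI ballI allI)
    show "(\<lambda>x. g x + c * h x) differentiable at x" if "x \<in> U" for x
      using D[OF that] by (auto simp: differentiable_def)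
    show "Ck_on k (\<lambda>x. frechet_derivative (\<lambda>x. g x + c * h x) (at x) v) U" for v
      using Suc.IH[of "\<lambda>x. frechet_derivative g (at x) v" "\<lambda>x. frechet_derivative h (at x) v"] Suc.prems
      by (subst Ck_on_cong[OF assms, where h = "\<lambda>x. frechet_derivative g (at x) v + c * frechet_derivative h (at x) v"])
         (auto simp: frechet_derivative_at[OF D, symmetric])
  qed
qed

lemma smooth_on_add_cmult:
  "open U \<Longrightarrow> smooth_on g U \<Longrightarrow> smooth_on h U \<Longrightarrow> smooth_on (\<lambda>x. g x + c * h x) U"
  by (simp add: smooth_on_def Ck_on_add_cmult)

text \<open>
  The real derivative in a fixed direction is a linear combination of partial derivatives, hence
  again separately holomorphic, and the argument can be iterated.
\<close>

lemma sep_holo_smooth: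
  fixes g :: "complex^'n \<Rightarrow> complex"
  assumes "open U" "sep_holo g U"
  shows "smooth_on g U"
proof -
  have "Ck_on k g U" for k
    using assms(2)
  proof (induction k arbitrary: g)
    case 0
    then show ?case by (simp add: sep_holo_def)
  next
    case (Suc k)
    show ?case unfolding Ck_on.simps
    proof (intro conjI ballI allI)
      show "g differentiable at x" if "x \<in> U" for x
        using sep_holo_has_derivative[OF assms(1) Suc.prems that] by (auto simp: differentiable_def)
      have "Ck_on k (\<lambda>x. \<Sum>i\<in>UNIV. v $ i * partial_deriv i g x) U" for v
        by (intro Suc.IH sep_holo_sum sep_holo_cmult sep_holo_partial_deriv assms(1) Suc.prems)
      then show "Ck_on k (\<lambda>x. frechet_derivative g (at x) v) U" for v
        by (subst Ck_on_cong[OF assms(1)]) (auto simp: sep_holo_frechet_derivative[OF assms(1) Suc.prems])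
    qed
  qed
  then show ?thesis by (simp add: smooth_on_def)
qed

section \<open>Continuous multilinear functionals\<close>

abbreviation clinear :: "('b::complex_vector \<Rightarrow> complex) \<Rightarrow> bool" where
  "clinear \<equiv> Vector_Spaces.linear scaleC scaleC"

lemma clinear_iff:
  "clinear L \<longleftrightarrow> (\<forall>x y. L (x + y) = L x + L y) \<and> (\<forall>c x. L (c *\<^sub>C x) = c * L x)"
  unfolding Vector_Spaces.linear_def module_hom_def module_hom_axioms_def vector_space_def module_def
  by (auto simp: scaleC_add_right scaleC_add_left scaleC_scaleC scaleC_one scaleC_complex_def algebra_simps)

lemma clinear_add: "clinear L \<Longrightarrow> L (x + y) = L x + L y"
  and clinear_scaleC: "clinear L \<Longrightarrow> L (c *\<^sub>C x) = c * L x"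
  by (simp_all add: clinear_iff)

lemma clinear_zero: "clinear L \<Longrightarrow> L 0 = 0"
  using clinear_add[of L 0 0] by simp

lemma clinear_diff: "clinear L \<Longrightarrow> L (x - y) = L x - L y"
  using clinear_add[of L "x - y" y] by simp

lemma clinear_sum: "clinear L \<Longrightarrow> L (\<Sum>x\<in>X. w x) = (\<Sum>x\<in>X. L (w x))"
  by (induction X rule: infinite_finite_induct) (auto simp: clinear_zero clinear_add)

lemma scaleC_zero_right: "c *\<^sub>C 0 = (0::'a::complex_vector)"
  using scaleC_add_right[of c "0::'a" 0] by simp

lemma map_upt_fun_upd: "i < m \<Longrightarrow> map (a(i := x)) [0..<m] = (map a [0..<m])[i := x]"
  by (rule nth_equalityI) (auto simp: nth_list_update)

lemma cont_multilinear_clinear: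
  assumes "\<phi> \<in> cont_multilinear m" "i < m"
  shows "clinear (\<lambda>x. \<phi> (map (a(i := x)) [0..<m]))"
  using assms by (simp add: cont_multilinear_def map_upt_fun_upd)

lemma cont_multilinear_tendsto:
  assumes \<phi>: "\<phi> \<in> cont_multilinear m" and lim: "\<And>k. k < m \<Longrightarrow> ((\<lambda>t. a t k) \<longlongrightarrow> l k) F"
  shows "((\<lambda>t. \<phi> (map (a t) [0..<m])) \<longlongrightarrow> \<phi> (map l [0..<m])) F"
proof -
  have cm: "continuous_map (product_topology (\<lambda>_::nat. euclidean) {..<m}) euclidean
        (\<lambda>a. \<phi> (map a [0..<m]))"
    using \<phi> by (simp add: cont_multilinear_def)
  have "limitin (product_topology (\<lambda>_::nat. euclidean) {..<m})
      (\<lambda>t. restrict (a t) {..<m}) (restrict l {..<m}) F"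
    using lim by (auto simp: limitin_componentwise)
  from continuous_map_limit[OF cm this]
  have "((\<lambda>t. \<phi> (map (restrict (a t) {..<m}) [0..<m])) \<longlongrightarrow> \<phi> (map (restrict l {..<m}) [0..<m])) F"
    by (simp add: o_def)
  moreover have "map (restrict b {..<m}) [0..<m] = map b [0..<m]" for b :: "nat \<Rightarrow> 'a"
    by simp
  ultimately show ?thesis by simp
qed

section \<open>Algebra-valued partial derivatives\<close>

lemma tendsto_scaleC:
  fixes x :: "'x \<Rightarrow> 'b::topological_complex_algebra"
  assumes "(c \<longlongrightarrow> c0) F" "(x \<longlongrightarrow> x0) F"
  shows "((\<lambda>t. c t *\<^sub>C x t) \<longlongrightarrow> c0 *\<^sub>C x0) F"
  using filterlim_compose[OF tendsto_scaleC_Pair filterlim_Pair[OF assms]] by simp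

lemma tendsto_along_axis:
  fixes F :: "complex^'n \<Rightarrow> 'b::topological_space"
  assumes "open U" "continuous_on U F" "z \<in> U"
  shows "((\<lambda>t. F (z + axis i t)) \<longlongrightarrow> F z) (at 0)"
proof -
  have "isCont (\<lambda>t. z + axis i t :: complex^'n) 0"
    using continuous_on_axis[of UNIV "\<lambda>t. t" i] continuous_on_eq_continuous_at[of UNIV]
    by (intro continuous_intros) auto
  then have "((\<lambda>t. z + axis i t) \<longlongrightarrow> z) (at 0)"
    by (simp add: isCont_def axis_zero)
  moreover have "isCont F z"
    using assms by (simp add: continuous_on_eq_continuous_at)
  ultimately show ?thesis by (rule isCont_tendsto_compose[rotated])
qed

lemma has_cpartial_scaleC:
  fixes F :: "complex^'n \<Rightarrow> 'b::topological_complex_algebra"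
  shows "has_cpartial F i z D \<Longrightarrow> has_cpartial (\<lambda>z. c *\<^sub>C F z) i z (c *\<^sub>C D)"
proof -
  assume "has_cpartial F i z D"
  then have "((\<lambda>t. c *\<^sub>C (inverse t *\<^sub>C (F (z + axis i t) - F z))) \<longlongrightarrow> c *\<^sub>C D) (at 0)"
    unfolding has_cpartial_def by (intro tendsto_scaleC tendsto_const)
  moreover have "c *\<^sub>C (inverse t *\<^sub>C (x - y)) = inverse t *\<^sub>C (c *\<^sub>C x - c *\<^sub>C y)" for t and x y :: 'b
    using scaleC_add_right[of c "x - y" y] by (simp add: scaleC_scaleC mult.commute)
  ultimately show ?thesis by (simp add: has_cpartial_def)
qed

lemma has_cpartial_add:
  fixes F G :: "complex^'n \<Rightarrow> 'b::topological_complex_algebra"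
  shows "has_cpartial F i z D \<Longrightarrow> has_cpartial G i z E \<Longrightarrow> has_cpartial (\<lambda>z. F z + G z) i z (D + E)"
proof -
  assume "has_cpartial F i z D" "has_cpartial G i z E"
  then have "((\<lambda>t. inverse t *\<^sub>C (F (z + axis i t) - F z) + inverse t *\<^sub>C (G (z + axis i t) - G z))
      \<longlongrightarrow> D + E) (at 0)"
    unfolding has_cpartial_def by (rule tendsto_add)
  then show ?thesis
    by (simp add: has_cpartial_def scaleC_add_right[symmetric] algebra_simps)
qed

lemma has_cpartial_zero: "has_cpartial (\<lambda>z. 0) i z (0::'b::topological_complex_algebra)"
  by (simp add: has_cpartial_def scaleC_zero_right)

lemma has_cpartial_sum:
  assumes "\<And>x. x \<in> X \<Longrightarrow> has_cpartial (F x) i z (D x)"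
  shows "has_cpartial (\<lambda>z. \<Sum>x\<in>X. F x z) i z (\<Sum>x\<in>X. D x)"
  using assms
  by (induction X rule: infinite_finite_induct) (auto intro: has_cpartial_add has_cpartial_zero)

lemma has_cpartial_mult:
  fixes F G :: "complex^'n \<Rightarrow> 'b::topological_complex_algebra"
  assumes F: "has_cpartial F i z D" and G: "has_cpartial G i z E"
    and U: "open U" "continuous_on U G" "z \<in> U"
  shows "has_cpartial (\<lambda>z. F z * G z) i z (D * G z + F z * E)"
proof -
  have "((\<lambda>t. (inverse t *\<^sub>C (F (z + axis i t) - F z)) * G (z + axis i t)
      + F z * (inverse t *\<^sub>C (G (z + axis i t) - G z))) \<longlongrightarrow> D * G z + F z * E) (at 0)"
    using F G unfolding has_cpartial_def
    by (intro tendsto_add tendsto_mult tendsto_const tendsto_along_axis[OF U])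
  moreover have "(inverse t *\<^sub>C (a - b)) * c + b * (inverse t *\<^sub>C (c - d)) = inverse t *\<^sub>C (a * c - b * d)"
    for t and a b c d :: 'b
    by (simp add: mult_scaleC_left mult_scaleC_right scaleC_add_right[symmetric] algebra_simps)
  ultimately show ?thesis by (simp add: has_cpartial_def)
qed

text \<open>
  Partial derivatives are local. This is used for \<open>\<partial>\<^sub>i f = f \<omega>\<^sub>i\<close>, which holds on the resolvent set only.
\<close>

lemma has_cpartial_cong:
  fixes F G :: "complex^'n \<Rightarrow> 'b::topological_complex_algebra"
  assumes G: "has_cpartial G i z D" and U: "open U" "z \<in> U" and eq: "\<And>w. w \<in> U \<Longrightarrow> F w = G w"
  shows "has_cpartial F i z D"
proof -
  have "((\<lambda>t. z + axis i t) \<longlongrightarrow> z) (at 0)"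
    by (rule tendsto_along_axis[OF open_UNIV, of "\<lambda>w. w"]) auto
  then have "\<forall>\<^sub>F t in at 0. z + axis i t \<in> U"
    using U by (rule topological_tendstoD)
  then have "\<forall>\<^sub>F t in at 0. inverse t *\<^sub>C (G (z + axis i t) - G z) = inverse t *\<^sub>C (F (z + axis i t) - F z)"
    by eventually_elim (use eq U in simp)
  then show ?thesis using G unfolding has_cpartial_def by (rule Lim_transform_eventually[rotated])
qed

lemma holomorphic_tva_cpartial:
  "holomorphic_tva F U \<Longrightarrow> z \<in> U \<Longrightarrow> has_cpartial F i z (cpartial F i z)"
  unfolding holomorphic_tva_def cpartial_def by (meson someI_ex)

lemma clinear_has_cpartial:
  assumes "clinear \<psi>" "continuous_on UNIV \<psi>" "has_cpartial F i z D"
  shows "((\<lambda>t. \<psi> (F (z + axis i t))) has_field_derivative \<psi> D) (at 0)"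
proof -
  have "((\<lambda>t. \<psi> (inverse t *\<^sub>C (F (z + axis i t) - F z))) \<longlongrightarrow> \<psi> D) (at 0)"
    by (rule continuous_on_tendsto_compose[OF assms(2)]) (use assms(3) in \<open>simp_all add: has_cpartial_def\<close>)
  then show ?thesis
    by (simp add: DERIV_def axis_zero clinear_scaleC[OF assms(1)] clinear_diff[OF assms(1)]
        divide_inverse mult.commute)
qed

text \<open>
  The increment telescopes by replacing the arguments one after the other. Each difference
  quotient is then a value of \<open>\<phi>\<close> with a difference quotient in one slot, and the joint continuity of \<open>\<phi>\<close> gives the limit.
\<close>

lemma cont_multilinear_deriv:
  fixes b :: "nat \<Rightarrow> complex^'n \<Rightarrow> 'b::topological_complex_algebra"
  assumes \<phi>: "\<phi> \<in> cont_multilinear m" and U: "open U" "z \<in> U"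
    and cont: "\<And>k. k < m \<Longrightarrow> continuous_on U (b k)"
    and D: "\<And>k. k < m \<Longrightarrow> has_cpartial (b k) i z (D k)"
  shows "((\<lambda>t. \<phi> (map (\<lambda>k. b k (z + axis i t)) [0..<m])) has_field_derivative
      (\<Sum>k<m. \<phi> (map ((\<lambda>k. b k z)(k := D k)) [0..<m]))) (at 0)"
proof -
  \<comment> \<open>In \<open>mix t k\<close> the arguments before the \<open>k\<close>-th are displaced by \<open>t\<close>, the others not yet.\<close>
  define mix where "mix t k = (\<lambda>l. if l < k then b l (z + axis i t) else b l z)" for t k
  define q where "q t k = inverse t *\<^sub>C (b k (z + axis i t) - b k z)" for t k
  have step: "\<phi> (map (mix t (Suc k)) [0..<m]) - \<phi> (map (mix t k) [0..<m])
      = \<phi> (map ((mix t k)(k := b k (z + axis i t) - b k z)) [0..<m])" if "k < m" for t k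
  proof -
    have "mix t (Suc k) = (mix t k)(k := b k (z + axis i t))" "mix t k = (mix t k)(k := b k z)"
      by (auto simp: mix_def fun_eq_iff)
    then show ?thesis
      using clinear_diff[OF cont_multilinear_clinear[OF \<phi> that], of "mix t k"] by metis
  qed
  have quot: "(\<phi> (map (\<lambda>k. b k (z + axis i t)) [0..<m]) - \<phi> (map (\<lambda>k. b k z) [0..<m])) / t
      = (\<Sum>k<m. \<phi> (map ((mix t k)(k := q t k)) [0..<m]))" for t
  proof -
    have "\<phi> (map (\<lambda>k. b k (z + axis i t)) [0..<m]) - \<phi> (map (\<lambda>k. b k z) [0..<m])
      = \<phi> (map (mix t m) [0..<m]) - \<phi> (map (mix t 0) [0..<m])"
      by (intro arg_cong2[where f = "(-)"] arg_cong[where f = \<phi>]) (auto simp: mix_def)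
    also have "\<dots> = (\<Sum>k<m. \<phi> (map (mix t (Suc k)) [0..<m]) - \<phi> (map (mix t k) [0..<m]))"
      by (rule sum_lessThan_telescope[symmetric])
    also have "\<dots> / t = (\<Sum>k<m. \<phi> (map ((mix t k)(k := q t k)) [0..<m]))"
      unfolding sum_divide_distrib
    proof (rule sum.cong[OF refl])
      fix k assume "k \<in> {..<m}"
      then have k: "k < m" by simp
      show "(\<phi> (map (mix t (Suc k)) [0..<m]) - \<phi> (map (mix t k) [0..<m])) / t
          = \<phi> (map ((mix t k)(k := q t k)) [0..<m])"
        unfolding step[OF k] q_def clinear_scaleC[OF cont_multilinear_clinear[OF \<phi> k]]
        by (simp add: divide_inverse mult.commute)
    qed
    finally show ?thesis .
  qed
  have "((\<lambda>t. \<Sum>k<m. \<phi> (map ((mix t k)(k := q t k)) [0..<m])) \<longlongrightarrow>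
      (\<Sum>k<m. \<phi> (map ((\<lambda>k. b k z)(k := D k)) [0..<m]))) (at 0)"
  proof (intro tendsto_sum cont_multilinear_tendsto[OF \<phi>])
    fix k l assume k: "k \<in> {..<m}" and l: "l < m"
    show "((\<lambda>t. ((mix t k)(k := q t k)) l) \<longlongrightarrow> ((\<lambda>k. b k z)(k := D k)) l) (at 0)"
    proof (cases "l = k")
      case True
      then show ?thesis using D[OF l] by (simp add: q_def has_cpartial_def)
    next
      case False
      then show ?thesis
        using tendsto_along_axis[OF U(1) cont[OF l] U(2)] by (cases "l < k") (simp_all add: mix_def)
    qed
  qed
  then show ?thesis by (simp add: DERIV_def quot axis_zero)
qed

lemma cont_multilinear_sep_holo:
  fixes b :: "nat \<Rightarrow> complex^'n \<Rightarrow> 'b::topological_complex_algebra"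
  assumes \<phi>: "\<phi> \<in> cont_multilinear m" and U: "open U"
    and b: "\<And>k. k < m \<Longrightarrow> holomorphic_tva (b k) U"
  shows "sep_holo (\<lambda>z. \<phi> (map (\<lambda>k. b k z) [0..<m])) U"
  unfolding sep_holo_def
proof (intro conjI ballI allI)
  show "continuous_on U (\<lambda>z. \<phi> (map (\<lambda>k. b k z) [0..<m]))"
    unfolding continuous_on_def
  proof
    fix z assume "z \<in> U"
    then show "((\<lambda>z. \<phi> (map (\<lambda>k. b k z) [0..<m])) \<longlongrightarrow> \<phi> (map (\<lambda>k. b k z) [0..<m])) (at z within U)"
      using b by (intro cont_multilinear_tendsto[OF \<phi>]) (auto simp: holomorphic_tva_def continuous_on_def)
  qed
  show "(\<lambda>t. \<phi> (map (\<lambda>k. b k (z + axis i t)) [0..<m])) field_differentiable (at 0)"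
    if z: "z \<in> U" for z i
    unfolding field_differentiable_def
    using cont_multilinear_deriv[OF \<phi> U z, of b i "\<lambda>k. cpartial (b k) i z"]
      holomorphic_tva_cpartial[OF b z] b by (auto simp: holomorphic_tva_def)
qed

section \<open>The structure equation of the logarithmic differential\<close>

lemma is_invertible_alg_inverse:
  assumes "is_invertible (a::'a::monoid_mult)"
  shows "a * alg_inverse a = 1" "alg_inverse a * a = 1"
proof -
  have "\<exists>!b. a * b = 1 \<and> b * a = 1"
    using assms unfolding is_invertible_def by (metis mult.assoc mult_1_left mult_1_right)
  from theI'[OF this] show "a * alg_inverse a = 1" "alg_inverse a * a = 1"
    by (auto simp: alg_inverse_def)
qed

text \<open>
  Apply the symmetry of second derivatives to the entire scalar function \<open>g(w) = \<psi>(f(z)\<inverse> f(w))\<close>, with \<open>z\<close> fixed.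
  By the product rule for \<open>\<partial>\<^sub>i f = f \<omega>\<^sub>i\<close>, its second derivative \<open>\<partial>\<^sub>j \<partial>\<^sub>i\<close> at \<open>z\<close> is
  \<open>\<psi>(f(z)\<inverse> (\<partial>\<^sub>j f \<omega>\<^sub>i + f \<partial>\<^sub>j \<omega>\<^sub>i))\<close>, and \<open>f\<inverse> \<partial>\<^sub>j f = \<omega>\<^sub>j\<close>.
\<close>

lemma omega_structure_coefficients:
  fixes f :: "complex^'n \<Rightarrow> 'b::topological_complex_algebra"
  assumes f: "holomorphic_tva f UNIV" and U: "open (resolvent_set f)"
    and om: "\<And>i. holomorphic_tva (omega f i) (resolvent_set f)"
    and \<psi>: "clinear \<psi>" "continuous_on UNIV \<psi>" and z: "z \<in> resolvent_set f"
  shows "\<psi> (cpartial (omega f i) j z + omega f j z * omega f i z)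
       = \<psi> (cpartial (omega f j) i z + omega f i z * omega f j z)"
proof -
  define c where "c = alg_inverse (f z)"
  define \<psi>' where "\<psi>' x = \<psi> (c * x)" for x
  have cfz: "c * f z = 1"
    using z is_invertible_alg_inverse(2) by (simp add: c_def resolvent_set_def)
  have \<psi>': "clinear \<psi>'" "continuous_on UNIV \<psi>'"
  proof -
    show "clinear \<psi>'"
      using \<psi>(1) by (simp add: clinear_iff \<psi>'_def distrib_left mult_scaleC_right)
    show "continuous_on UNIV \<psi>'"
      unfolding \<psi>'_def continuous_on_def
    proof
      fix x
      have "((\<lambda>x. c * x) \<longlongrightarrow> c * x) (at x)"
        by (intro tendsto_mult tendsto_const tendsto_ident_at)
      then show "((\<lambda>x. \<psi> (c * x)) \<longlongrightarrow> \<psi> (c * x)) (at x)"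
        by (rule continuous_on_tendsto_compose[OF \<psi>(2)]) auto
    qed
  qed
  define g where "g w = \<psi>' (f w)" for w
  have Dg: "((\<lambda>t. g (w + axis i t)) has_field_derivative \<psi>' (cpartial f i w)) (at 0)" for w i
    unfolding g_def by (rule clinear_has_cpartial[OF \<psi>' holomorphic_tva_cpartial[OF f UNIV_I]])
  have g: "sep_holo g UNIV"
    unfolding sep_holo_def
  proof (intro conjI ballI allI)
    show "continuous_on UNIV g"
      unfolding g_def by (rule continuous_on_compose2[OF \<psi>'(2)]) (use f in \<open>auto simp: holomorphic_tva_def\<close>)
  qed (use Dg in \<open>auto simp: field_differentiable_def\<close>)
  have pdg: "partial_deriv i g = (\<lambda>w. \<psi>' (cpartial f i w))" for i
    using partial_deriv_eqI[OF Dg] by blast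
  have "has_cpartial (cpartial f i) j z
      (cpartial f j z * omega f i z + f z * cpartial (omega f i) j z)" for i j
  proof (rule has_cpartial_cong[OF has_cpartial_mult U z])
    show "cpartial f i w = f w * omega f i w" if "w \<in> resolvent_set f" for w
      using that is_invertible_alg_inverse(1)[of "f w"]
      by (simp add: omega_def resolvent_set_def mult.assoc[symmetric])
    show "has_cpartial f j z (cpartial f j z)"
      by (rule holomorphic_tva_cpartial[OF f UNIV_I])
    show "has_cpartial (omega f i) j z (cpartial (omega f i) j z)"
      by (rule holomorphic_tva_cpartial[OF om z])
    show "continuous_on (resolvent_set f) (omega f i)"
      using om by (simp add: holomorphic_tva_def)
  qed (use U z in auto)
  then have "partial_deriv j (partial_deriv i g) z = \<psi>' (cpartial f j z * omega f i z + f z * cpartial (omega f i) j z)" for i j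
    unfolding pdg by (intro partial_deriv_eqI clinear_has_cpartial \<psi>')
  moreover have "c * (cpartial f j z * omega f i z + f z * cpartial (omega f i) j z)
      = cpartial (omega f i) j z + omega f j z * omega f i z" for i j
    using cfz by (simp add: distrib_left mult.assoc[symmetric] omega_def c_def add.commute)
  ultimately have "partial_deriv j (partial_deriv i g) z = \<psi> (cpartial (omega f i) j z + omega f j z * omega f i z)" for i j
    by (simp add: \<psi>'_def)
  then show ?thesis using partial_deriv_commute[OF open_UNIV g UNIV_I, of j i z] by simp
qed

definition omega_at ::
  "(complex^'n \<Rightarrow> 'b::topological_complex_algebra) \<Rightarrow> complex^'n \<Rightarrow> complex^'n \<Rightarrow> 'b" where
  "omega_at f z v = (\<Sum>i\<in>UNIV. (v $ i) *\<^sub>C omega f i z)"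

text \<open>
  The derivative of \<open>\<omega>(w)\<close>, for a constant vector \<open>w\<close>, in the direction \<open>v\<close>.
\<close>

definition omega_deriv ::
  "(complex^'n \<Rightarrow> 'b::topological_complex_algebra) \<Rightarrow> complex^'n \<Rightarrow> complex^'n \<Rightarrow> complex^'n \<Rightarrow> 'b" where
  "omega_deriv f z v w = (\<Sum>j\<in>UNIV. \<Sum>i\<in>UNIV. (v $ j * w $ i) *\<^sub>C cpartial (omega f i) j z)"

lemma omega_at_add: "omega_at f z (v + w) = omega_at f z v + omega_at f z w"
  by (simp add: omega_at_def scaleC_add_left sum.distrib)

lemma scaleC_sum: "c *\<^sub>C (\<Sum>x\<in>X. w x) = (\<Sum>x\<in>X. c *\<^sub>C w x)"
  for w :: "'x \<Rightarrow> 'a::complex_vector"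
  by (induction X rule: infinite_finite_induct) (simp_all add: scaleC_add_right scaleC_zero_right)

lemma omega_at_scaleR: "omega_at f z (r *\<^sub>R v) = complex_of_real r *\<^sub>C omega_at f z v"
  unfolding omega_at_def scaleC_sum by (simp add: scaleC_scaleC scaleR_conv_of_real[where 'a = complex])

lemma omega_at_holomorphic:
  fixes f :: "complex^'n \<Rightarrow> 'b::topological_complex_algebra"
  assumes om: "\<And>i. holomorphic_tva (omega f i) U"
  shows "holomorphic_tva (\<lambda>z. omega_at f z w) U"
    and "z \<in> U \<Longrightarrow> has_cpartial (\<lambda>z. omega_at f z w) j z
           (\<Sum>i\<in>UNIV. (w $ i) *\<^sub>C cpartial (omega f i) j z)"
proof -
  have D: "has_cpartial (\<lambda>z. omega_at f z w) j z (\<Sum>i\<in>UNIV. (w $ i) *\<^sub>C cpartial (omega f i) j z)"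
    if "z \<in> U" for z j
    unfolding omega_at_def
    by (intro has_cpartial_sum has_cpartial_scaleC holomorphic_tva_cpartial[OF om that])
  then show "z \<in> U \<Longrightarrow> has_cpartial (\<lambda>z. omega_at f z w) j z
      (\<Sum>i\<in>UNIV. (w $ i) *\<^sub>C cpartial (omega f i) j z)" .
  have "continuous_on U (\<lambda>z. omega_at f z w)"
    unfolding omega_at_def continuous_on_def
    using om by (auto intro!: tendsto_sum tendsto_scaleC simp: holomorphic_tva_def continuous_on_def)
  then show "holomorphic_tva (\<lambda>z. omega_at f z w) U"
    using D unfolding holomorphic_tva_def by blast
qed

text \<open>
  This is \<open>d\<omega> + \<omega> \<and> \<omega> = 0\<close> evaluated on \<open>(v, w)\<close>, written as the symmetry of an expression in \<open>v\<close>
  and \<open>w\<close>. In this form it is exactly what makes an alternating sum vanish.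
\<close>

lemma omega_structure_equation:
  fixes f :: "complex^'n \<Rightarrow> 'b::topological_complex_algebra"
  assumes f: "holomorphic_tva f UNIV" and U: "open (resolvent_set f)"
    and om: "\<And>i. holomorphic_tva (omega f i) (resolvent_set f)"
    and \<psi>: "clinear \<psi>" "continuous_on UNIV \<psi>" and z: "z \<in> resolvent_set f"
  shows "\<psi> (omega_deriv f z v w + omega_at f z v * omega_at f z w)
       = \<psi> (omega_deriv f z w v + omega_at f z w * omega_at f z v)"
proof -
  have exp: "\<psi> (omega_deriv f z v w + omega_at f z v * omega_at f z w)
     = (\<Sum>j\<in>UNIV. \<Sum>i\<in>UNIV. v $ j * w $ i * \<psi> (cpartial (omega f i) j z + omega f j z * omega f i z))"
    for v w
    by (simp add: omega_deriv_def omega_at_def clinear_add[OF \<psi>(1)] clinear_sum[OF \<psi>(1)]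
        clinear_scaleC[OF \<psi>(1)] sum_product sum.distrib distrib_left mult_scaleC_left mult_scaleC_right
        scaleC_scaleC mult.commute)
  show ?thesis
    unfolding exp
    by (subst sum.swap, intro sum.cong refl)
       (simp add: omega_structure_coefficients[OF f U om \<psi> z] mult.commute)
qed

lemma cont_multilinear_slot_continuous:
  assumes "\<phi> \<in> cont_multilinear m"
  shows "continuous_on UNIV (\<lambda>x. \<phi> (map (a(k := x)) [0..<m]))"
  unfolding continuous_on_def
proof
  fix x
  show "((\<lambda>x. \<phi> (map (a(k := x)) [0..<m])) \<longlongrightarrow> \<phi> (map (a(k := x)) [0..<m])) (at x)"
    by (rule cont_multilinear_tendsto[OF assms]) simp
qed

lemma omega_functional_has_derivative:
  fixes f :: "complex^'n \<Rightarrow> 'b::topological_complex_algebra"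
  assumes \<phi>: "\<phi> \<in> cont_multilinear m" and U: "open U"
    and om: "\<And>i. holomorphic_tva (omega f i) U" and z: "z \<in> U"
  shows "((\<lambda>z. \<phi> (map (\<lambda>k. omega_at f z (u k)) [0..<m])) has_derivative
     (\<lambda>v. \<Sum>k<m. \<phi> (map ((\<lambda>k. omega_at f z (u k))(k := omega_deriv f z v (u k))) [0..<m]))) (at z)"
proof -
  let ?g = "\<lambda>z. \<phi> (map (\<lambda>k. omega_at f z (u k)) [0..<m])"
  let ?P = "\<lambda>k j. \<Sum>i\<in>UNIV. (u k $ i) *\<^sub>C cpartial (omega f i) j z"
  have g: "sep_holo ?g U"
    by (intro cont_multilinear_sep_holo[OF \<phi> U] omega_at_holomorphic om)
  have pdg: "partial_deriv j ?g z = (\<Sum>k<m. \<phi> (map ((\<lambda>k. omega_at f z (u k))(k := ?P k j)) [0..<m]))" for j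
    using omega_at_holomorphic[OF om] z
    by (intro partial_deriv_eqI cont_multilinear_deriv[OF \<phi> U]) (auto simp: holomorphic_tva_def)
  have "(\<Sum>j\<in>UNIV. v $ j * partial_deriv j ?g z)
      = (\<Sum>k<m. \<phi> (map ((\<lambda>k. omega_at f z (u k))(k := omega_deriv f z v (u k))) [0..<m]))" for v
  proof -
    have "(\<Sum>j\<in>UNIV. v $ j * partial_deriv j ?g z)
      = (\<Sum>k<m. \<Sum>j\<in>UNIV. v $ j * \<phi> (map ((\<lambda>k. omega_at f z (u k))(k := ?P k j)) [0..<m]))"
      unfolding pdg sum_distrib_left by (rule sum.swap)
    also have "\<dots> = (\<Sum>k<m. \<phi> (map ((\<lambda>k. omega_at f z (u k))(k := omega_deriv f z v (u k))) [0..<m]))"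
    proof (rule sum.cong[OF refl])
      fix k assume "k \<in> {..<m}"
      then have L: "clinear (\<lambda>x. \<phi> (map ((\<lambda>k. omega_at f z (u k))(k := x)) [0..<m]))"
        using cont_multilinear_clinear[OF \<phi>] by simp
      show "(\<Sum>j\<in>UNIV. v $ j * \<phi> (map ((\<lambda>k. omega_at f z (u k))(k := ?P k j)) [0..<m]))
        = \<phi> (map ((\<lambda>k. omega_at f z (u k))(k := omega_deriv f z v (u k))) [0..<m])"
        unfolding omega_deriv_def clinear_sum[OF L] clinear_scaleC[OF L]
        by (simp add: sum_distrib_left mult.assoc)
    qed
    finally show ?thesis .
  qed
  then show ?thesis using sep_holo_has_derivative[OF U g z] by simp
qed

section \<open>Alternating sums over permutations\<close>

definition alt_sum :: "nat \<Rightarrow> ((nat \<Rightarrow> 'v) \<Rightarrow> complex) \<Rightarrow> (nat \<Rightarrow> 'v) \<Rightarrow> complex" where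
  "alt_sum m G u = (\<Sum>\<pi> | \<pi> permutes {..<m}. of_int (sign \<pi>) * G (u \<circ> \<pi>))"

lemma permutes_lessThan_permutation: "\<pi> permutes {..<m::nat} \<Longrightarrow> permutation \<pi>"
  using permutation_permutes by blast

lemma alt_sum_compose:
  assumes \<tau>: "\<tau> permutes {..<m}"
  shows "alt_sum m (\<lambda>u. G (u \<circ> \<tau>)) u = of_int (sign \<tau>) * alt_sum m G u"
proof -
  have "alt_sum m G u = (\<Sum>\<pi> | \<pi> permutes {..<m}. of_int (sign (\<pi> \<circ> \<tau>)) * G (u \<circ> (\<pi> \<circ> \<tau>)))"
    unfolding alt_sum_def by (rule sum_permutations_compose_right[OF \<tau>])
  also have "\<dots> = (\<Sum>\<pi> | \<pi> permutes {..<m}. of_int (sign \<tau>) * (of_int (sign \<pi>) * G ((u \<circ> \<pi>) \<circ> \<tau>)))"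
    by (intro sum.cong refl)
       (simp add: sign_compose permutes_lessThan_permutation permutes_lessThan_permutation[OF \<tau>] comp_assoc mult.commute)
  finally have "alt_sum m G u = of_int (sign \<tau>) * alt_sum m (\<lambda>u. G (u \<circ> \<tau>)) u"
    by (simp add: alt_sum_def sum_distrib_left)
  moreover have "of_int (sign \<tau>) * (of_int (sign \<tau>) :: complex) = 1"
    by (simp flip: of_int_mult)
  ultimately show ?thesis by (simp add: mult.assoc[symmetric])
qed

text \<open>
  A function that is symmetric in two of its arguments alternates to zero, because the sum changes sign
  under the corresponding reindexing.
\<close>

lemma alt_sum_symmetric_zero:
  assumes "a < m" "b < m" "a \<noteq> b" and "\<And>\<pi>. \<pi> permutes {..<m} \<Longrightarrow> G (u \<circ> \<pi> \<circ> Transposition.transpose a b) = G (u \<circ> \<pi>)"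
  shows "alt_sum m G u = 0"
proof -
  have \<tau>: "Transposition.transpose a b permutes {..<m}"
    using assms by (intro permutes_swap_id) auto
  have "alt_sum m G u = alt_sum m (\<lambda>u. G (u \<circ> Transposition.transpose a b)) u"
    unfolding alt_sum_def using assms(4) by (intro sum.cong) auto
  also have "\<dots> = - alt_sum m G u"
    using assms by (simp add: alt_sum_compose[OF \<tau>] sign_swap_id)
  finally show ?thesis by simp
qed

text \<open>
  Composing the permutations with the transposition on the side of the vectors exchanges two equal vectors and
  changes the sign. This is what makes the forms \<open>\<phi>(\<omega>, \<dots>, \<omega>)\<close> alternating.
\<close>

lemma alt_sum_repeated_zero:
  assumes "i < m" "j < m" "i \<noteq> j" "u i = u j"
  shows "alt_sum m G u = 0"
proof -
  have \<tau>: "Transposition.transpose i j permutes {..<m}"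
    using assms by (intro permutes_swap_id) auto
  have eq: "u \<circ> Transposition.transpose i j = u"
    using assms by (auto simp: fun_eq_iff Transposition.transpose_def)
  have "alt_sum m G u = (\<Sum>\<pi> | \<pi> permutes {..<m}. of_int (sign (Transposition.transpose i j \<circ> \<pi>)) * G (u \<circ> (Transposition.transpose i j \<circ> \<pi>)))"
    unfolding alt_sum_def by (rule setum_permutations_compose_left[OF \<tau>])
  also have "\<dots> = - alt_sum m G u"
    unfolding alt_sum_def comp_assoc[symmetric] eq using assms
    by (simp add: sign_compose permutes_lessThan_permutation permutation_swap_id sign_swap_id sum_negf)
  finally show ?thesis by simp
qed

lemma alt_sum_add: "alt_sum m (\<lambda>u. G u + H u) u = alt_sum m G u + alt_sum m H u"
  by (simp add: alt_sum_def distrib_left sum.distrib)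

lemma alt_sum_cmult: "alt_sum m (\<lambda>u. c * G u) u = c * alt_sum m G u"
  by (simp add: alt_sum_def sum_distrib_left mult.left_commute)

lemma alt_sum_sum: "alt_sum m (\<lambda>u. \<Sum>x\<in>X. G x u) u = (\<Sum>x\<in>X. alt_sum m (G x) u)"
  unfolding alt_sum_def sum_distrib_left by (rule sum.swap)

text \<open>
  The cycle that moves index \<open>b\<close> to the last place \<open>m\<close> and closes the gap. It serves three purposes: it removes the
  \<open>b\<close>-th vector from a list while remembering it at the end, it enumerates the arguments left after two neighbours
  have been merged, and for \<open>b = 0\<close> it is the cyclic rotation.
\<close>

definition shift_to_end :: "nat \<Rightarrow> nat \<Rightarrow> nat \<Rightarrow> nat" where
  "shift_to_end m b a = (if a < b then a else if a < m then Suc a else if a = m then b else a)"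

lemma shift_to_end_step:
  assumes "b < m"
  shows "shift_to_end m b = Transposition.transpose b (Suc b) \<circ> shift_to_end m (Suc b)"
  using assms by (auto simp: fun_eq_iff shift_to_end_def Transposition.transpose_def)

lemma shift_to_end_permutes:
  assumes "b \<le> m"
  shows "shift_to_end m b permutes {..<Suc m} \<and> sign (shift_to_end m b) = (- 1) ^ (m - b)"
  using assms
proof (induction rule: inc_induct)
  case base
  have "shift_to_end m m = id"
    by (auto simp: fun_eq_iff shift_to_end_def)
  then show ?case by (metis permutes_id sign_id diff_self_eq_0 power_0)
next
  case (step b)
  have \<tau>: "Transposition.transpose b (Suc b) permutes {..<Suc m}"
    using step by (intro permutes_swap_id) auto
  have "m - b = Suc (m - Suc b)" using step by simp
  moreover have "sign (Transposition.transpose b (Suc b) \<circ> shift_to_end m (Suc b)) = - sign (shift_to_end m (Suc b))"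
    using step by (subst sign_compose) (auto intro: permutes_lessThan_permutation simp: permutation_swap_id sign_swap_id)
  moreover have "Transposition.transpose b (Suc b) \<circ> shift_to_end m (Suc b) permutes {..<Suc m}"
    using step \<tau> by (blast intro: permutes_compose)
  moreover have "- ((- 1) ^ (m - Suc b)) = ((- 1) ^ (m - b) :: int)"
    using \<open>m - b = Suc (m - Suc b)\<close> by simp
  moreover have "sign (shift_to_end m (Suc b)) = (- 1) ^ (m - Suc b)"
    using step.IH by blast
  ultimately show ?case
    unfolding shift_to_end_step[OF step(2)] by (simp only:)
qed

lemmas shift_permutes = shift_to_end_permutes[THEN conjunct1]
lemmas shift_sign = shift_to_end_permutes[THEN conjunct2]

lemma of_int_sign_shift: "b \<le> m \<Longrightarrow> of_int (sign (shift_to_end m b)) = ((- 1) ^ (m - b) :: complex)"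
  by (simp add: shift_sign)

text \<open>
  The permutations of \<open>m + 1\<close> indices are sorted by the image \<open>b\<close> of the last one. The fact \<open>sum_over_permutations_insert\<close>
  takes the transposition of \<open>b\<close> and \<open>m\<close> as coset representative; the cycle has the same value at \<open>m\<close>, so the two differ
  by a permutation of the remaining indices.
\<close>

lemma sum_permutations_last:
  "(\<Sum>\<sigma> | \<sigma> permutes {..<Suc m}. F \<sigma>)
     = (\<Sum>b\<le>m. \<Sum>\<pi> | \<pi> permutes {..<m}. F (shift_to_end m b \<circ> \<pi>) :: complex)"
proof -
  have ins: "{..<Suc m} = insert m {..<m}" "{..m} = insert m {..<m}" by auto
  have "(\<Sum>\<sigma> | \<sigma> permutes {..<Suc m}. F \<sigma>)
      = (\<Sum>b\<le>m. \<Sum>\<pi> | \<pi> permutes {..<m}. F (Transposition.transpose m b \<circ> \<pi>))"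
    unfolding ins by (rule sum_over_permutations_insert) auto
  also have "\<dots> = (\<Sum>b\<le>m. \<Sum>\<pi> | \<pi> permutes {..<m}. F (shift_to_end m b \<circ> \<pi>))"
  proof (rule sum.cong[OF refl])
    fix b assume b: "b \<in> {..m}"
    define r where "r = Transposition.transpose m b \<circ> shift_to_end m b"
    have rS: "r permutes {..<Suc m}"
      unfolding r_def using b by (intro permutes_compose shift_permutes permutes_swap_id) auto
    have "r m = m" using b by (auto simp: r_def shift_to_end_def)
    then have r: "r permutes {..<m}"
      by (intro permutes_superset[OF rS]) (auto simp: less_Suc_eq)
    have "Transposition.transpose m b \<circ> r = shift_to_end m b"
      by (simp add: r_def comp_assoc[symmetric])
    then show "(\<Sum>\<pi> | \<pi> permutes {..<m}. F (Transposition.transpose m b \<circ> \<pi>))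
        = (\<Sum>\<pi> | \<pi> permutes {..<m}. F (shift_to_end m b \<circ> \<pi>))"
      by (subst setum_permutations_compose_left[OF r]) (simp add: comp_assoc[symmetric])
  qed
  finally show ?thesis .
qed

text \<open>
  The right-hand sum has the shape of the exterior derivative: one vector is singled out with sign \<open>(-1)\<^sup>b\<close> and
  the remaining ones are alternated.
\<close>

lemma alt_sum_Suc:
  "alt_sum (Suc m) H u = (- 1) ^ m * (\<Sum>b\<le>m. (- 1) ^ b * alt_sum m H (u \<circ> shift_to_end m b))"
proof -
  have "alt_sum (Suc m) H u = (\<Sum>b\<le>m. \<Sum>\<pi> | \<pi> permutes {..<m}.
      of_int (sign (shift_to_end m b \<circ> \<pi>)) * H (u \<circ> (shift_to_end m b \<circ> \<pi>)))"
    unfolding alt_sum_def by (rule sum_permutations_last)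
  also have "\<dots> = (\<Sum>b\<le>m. (- 1) ^ m * ((- 1) ^ b * alt_sum m H (u \<circ> shift_to_end m b)))"
  proof (rule sum.cong[OF refl])
    fix b assume b: "b \<in> {..m}"
    have sgn: "(- 1) ^ (m - b) = (- 1) ^ m * ((- 1) ^ b :: complex)"
      using b by (simp add: power_add[symmetric] minus_one_power_iff)
    have perm: "permutation (shift_to_end m b)"
      using b shift_permutes permutes_lessThan_permutation by blast
    show "(\<Sum>\<pi> | \<pi> permutes {..<m}.
        of_int (sign (shift_to_end m b \<circ> \<pi>)) * H (u \<circ> (shift_to_end m b \<circ> \<pi>)))
      = (- 1) ^ m * ((- 1) ^ b * alt_sum m H (u \<circ> shift_to_end m b))"
      unfolding mult.assoc[symmetric] sgn[symmetric] alt_sum_def sum_distrib_left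
      using b
      by (intro sum.cong refl)
         (simp add: sign_compose perm permutes_lessThan_permutation shift_sign comp_assoc)
  qed
  finally show ?thesis by (simp add: sum_distrib_left)
qed

lemma alt_sum_shift:
  "b \<le> m \<Longrightarrow> alt_sum (Suc m) (\<lambda>u. G (u \<circ> shift_to_end m b)) u = (- 1) ^ (m - b) * alt_sum (Suc m) G u"
  using alt_sum_compose[OF shift_permutes, of b m G u] by (simp add: of_int_sign_shift)

section \<open>Multilinear expansion over multi-indices\<close>

text \<open>
  Multilinearity without continuity. It is formulated for arguments indexed by natural numbers, where replacing
  an argument is a function update.
\<close>

definition slot_linear :: "nat \<Rightarrow> ('b::complex_vector list \<Rightarrow> complex) \<Rightarrow> bool" where
  "slot_linear m F \<longleftrightarrow> (\<forall>a. \<forall>i<m. clinear (\<lambda>x. F (map (a(i := x)) [0..<m])))"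

lemma cont_multilinear_slot_linear: "\<phi> \<in> cont_multilinear m \<Longrightarrow> slot_linear m \<phi>"
  by (simp add: slot_linear_def cont_multilinear_clinear)

lemma sum_lists_Suc:
  "(\<Sum>I | length I = Suc k. g I) = (\<Sum>I | length I = k. \<Sum>i\<in>UNIV. g (I @ [i]))"
  for g :: "'n::finite list \<Rightarrow> complex"
proof -
  have eq: "{I::'n list. length I = Suc k} = (\<lambda>(I, i). I @ [i]) ` ({I. length I = k} \<times> UNIV)"
  proof (intro equalityI subsetI)
    fix I :: "'n list" assume "I \<in> {I. length I = Suc k}"
    then show "I \<in> (\<lambda>(I, i). I @ [i]) ` ({I. length I = k} \<times> UNIV)"
      by (intro image_eqI[where x = "(butlast I, last I)"]) (auto intro: append_butlast_last_id[symmetric])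
  qed auto
  have inj: "inj_on (\<lambda>(I, i). I @ [i]) ({I::'n list. length I = k} \<times> UNIV)"
    by (auto simp: inj_on_def)
  then show ?thesis
    unfolding eq sum.reindex[OF inj] sum.cartesian_product by (simp add: case_prod_unfold)
qed

text \<open>
  Expanding only the first \<open>k\<close> arguments, with arbitrary entries in the others, makes the statement amenable to
  induction.
\<close>

lemma multilinear_expansion_prefix:
  fixes w :: "'n::finite \<Rightarrow> 'b::complex_vector"
  assumes F: "slot_linear m F"
  shows "k \<le> m \<Longrightarrow> F (map (\<lambda>a. if a < k then \<Sum>i\<in>UNIV. c a i *\<^sub>C w i else x a) [0..<m])
    = (\<Sum>I | length I = k. (\<Prod>a<k. c a (I ! a)) * F (map (\<lambda>a. if a < k then w (I ! a) else x a) [0..<m]))"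
proof (induction k arbitrary: x)
  case 0
  have "{I::'n list. length I = 0} = {[]}" by auto
  then show ?case by simp
next
  case (Suc k)
  have L: "clinear (\<lambda>y. F (map (b(k := y)) [0..<m]))" for b
    using F Suc.prems by (simp add: slot_linear_def)
  let ?x = "x(k := \<Sum>i\<in>UNIV. c k i *\<^sub>C w i)"
  have "F (map (\<lambda>a. if a < Suc k then \<Sum>i\<in>UNIV. c a i *\<^sub>C w i else x a) [0..<m])
      = F (map (\<lambda>a. if a < k then \<Sum>i\<in>UNIV. c a i *\<^sub>C w i else ?x a) [0..<m])"
    by (intro arg_cong[where f = F]) (auto simp: less_Suc_eq)
  also have "\<dots> = (\<Sum>I | length I = k. (\<Prod>a<k. c a (I ! a)) * F (map (\<lambda>a. if a < k then w (I ! a) else ?x a) [0..<m]))"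
    using Suc by simp
  also have "\<dots> = (\<Sum>I | length I = k. \<Sum>i\<in>UNIV. (\<Prod>a<Suc k. c a ((I @ [i]) ! a)) *
      F (map (\<lambda>a. if a < Suc k then w ((I @ [i]) ! a) else x a) [0..<m]))"
  proof (intro sum.cong refl)
    fix I :: "'n list" assume "I \<in> {I. length I = k}"
    then have I: "length I = k" by simp
    let ?b = "\<lambda>a. if a < k then w (I ! a) else x a"
    have "F (map (\<lambda>a. if a < k then w (I ! a) else ?x a) [0..<m])
        = F (map (?b(k := \<Sum>i\<in>UNIV. c k i *\<^sub>C w i)) [0..<m])"
      by (intro arg_cong[where f = F]) auto
    also have "\<dots> = (\<Sum>i\<in>UNIV. c k i * F (map (?b(k := w i)) [0..<m]))"
      by (simp only: clinear_sum[OF L] clinear_scaleC[OF L])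
    also have "\<dots> = (\<Sum>i\<in>UNIV. c k i * F (map (\<lambda>a. if a < Suc k then w ((I @ [i]) ! a) else x a) [0..<m]))"
      using I by (intro sum.cong refl arg_cong2[where f = "(*)"] arg_cong[where f = F]) (auto simp: nth_append)
    finally have *: "F (map (\<lambda>a. if a < k then w (I ! a) else ?x a) [0..<m])
        = (\<Sum>i\<in>UNIV. c k i * F (map (\<lambda>a. if a < Suc k then w ((I @ [i]) ! a) else x a) [0..<m]))" .
    have **: "(\<Prod>a<Suc k. c a ((I @ [i]) ! a)) = (\<Prod>a<k. c a (I ! a)) * c k i" for i
      using I by (simp add: nth_append)
    show "(\<Prod>a<k. c a (I ! a)) * F (map (\<lambda>a. if a < k then w (I ! a) else ?x a) [0..<m])
      = (\<Sum>i\<in>UNIV. (\<Prod>a<Suc k. c a ((I @ [i]) ! a)) *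
      F (map (\<lambda>a. if a < Suc k then w ((I @ [i]) ! a) else x a) [0..<m]))"
      unfolding * ** by (simp add: sum_distrib_left mult.assoc)
  qed
  finally show ?case unfolding sum_lists_Suc .
qed

lemma multilinear_expansion:
  fixes w :: "'n::finite \<Rightarrow> 'b::complex_vector"
  assumes F: "slot_linear m F"
  shows "F (map (\<lambda>a. \<Sum>i\<in>UNIV. c a i *\<^sub>C w i) [0..<m])
    = (\<Sum>I | length I = m. (\<Prod>a<m. c a (I ! a)) * F (map (\<lambda>a. w (I ! a)) [0..<m]))"
proof -
  have eq: "map (\<lambda>a. if a < m then g a else h a) [0..<m] = map g [0..<m]" for g h :: "nat \<Rightarrow> 'b"
    by simp
  show ?thesis
    using multilinear_expansion_prefix[OF F order_refl, of c w undefined] unfolding eq .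
qed

section \<open>The forms attached to cochains\<close>

text \<open>
  The determinant in the definition of the wedge product supplies the sum over permutations; for each of them
  the sum over multi-indices is a multilinear expansion read backwards. The functional \<open>F\<close> is
  general enough to be a cochain as well as the coboundary of one.
\<close>

lemma kappa_eq_alt_sum:
  fixes f :: "complex^'n \<Rightarrow> 'b::topological_complex_algebra"
  assumes F: "slot_linear (Suc p) F" and z: "z \<in> resolvent_set f" and vs: "length vs = Suc p"
  shows "kappa f p F z vs = alt_sum (Suc p) (\<lambda>u. F (map (\<lambda>a. omega_at f z (u a)) [0..<Suc p])) (\<lambda>a. vs ! a)"
proof -
  define m where "m = Suc p"
  have "kappa f p F z vs = (\<Sum>I | length I = m. F (map (\<lambda>a. omega f (I ! a) z) [0..<m]) *
      (\<Sum>\<pi> | \<pi> permutes {..<m}. of_int (sign \<pi>) * (\<Prod>a<m. (vs ! \<pi> a) $ (I ! a))))"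
  proof -
    have "map2 (\<lambda>\<eta> i. \<eta> i z) (replicate m (omega f)) I = map (\<lambda>a. omega f (I ! a) z) [0..<m]"
      if "length I = m" for I
      using that by (intro nth_equalityI) auto
    then show ?thesis
      using z vs unfolding kappa_def eval_on_forms_def wedge_dz_def by (simp add: m_def)
  qed
  also have "\<dots> = (\<Sum>\<pi> | \<pi> permutes {..<m}. of_int (sign \<pi>) * (\<Sum>I | length I = m.
      (\<Prod>a<m. (vs ! \<pi> a) $ (I ! a)) * F (map (\<lambda>a. omega f (I ! a) z) [0..<m])))"
    unfolding sum_distrib_left by (subst sum.swap) (simp add: ac_simps)
  also have "\<dots> = (\<Sum>\<pi> | \<pi> permutes {..<m}. of_int (sign \<pi>) *
      F (map (\<lambda>a. \<Sum>i\<in>UNIV. ((vs ! \<pi> a) $ i) *\<^sub>C omega f i z) [0..<m]))"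
    using multilinear_expansion[of m F "\<lambda>a i. (vs ! _ a) $ i" "\<lambda>i. omega f i z"] F m_def
    by (simp add: multilinear_expansion)
  finally show ?thesis by (simp add: alt_sum_def omega_at_def m_def o_def)
qed

text \<open>
  In the summand of \<open>\<pi>\<close>, the \<open>i\<close>-th vector occurs in the slot \<open>\<pi>\<inverse> i\<close> and nowhere else.
\<close>

lemma alt_sum_slot_linear:
  fixes \<Omega> :: "'v::real_vector \<Rightarrow> 'b::complex_vector"
  assumes F: "slot_linear m F" and i: "i < m" and vs: "length vs = m"
    and \<Omega>: "\<And>v w. \<Omega> (v + w) = \<Omega> v + \<Omega> w" "\<And>r v. \<Omega> (r *\<^sub>R v) = complex_of_real r *\<^sub>C \<Omega> v"
  shows "linear (\<lambda>v. alt_sum m (\<lambda>u. F (map (\<lambda>a. \<Omega> (u a)) [0..<m])) (\<lambda>a. vs[i := v] ! a))"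
  unfolding alt_sum_def
proof (rule linear_compose_sum, intro ballI)
  fix \<pi> assume "\<pi> \<in> {\<pi>. \<pi> permutes {..<m}}"
  then have \<pi>: "\<pi> permutes {..<m}" by simp
  define k where "k = inv \<pi> i"
  have k: "k < m" "\<pi> k = i"
    using permutes_in_image[OF permutes_inv[OF \<pi>], of i] i permutes_inverses(1)[OF \<pi>]
    by (auto simp: k_def)
  have eq: "map (\<lambda>a. \<Omega> (((\<lambda>a. vs[i := v] ! a) \<circ> \<pi>) a)) [0..<m] = map ((\<lambda>a. \<Omega> (vs ! \<pi> a))(k := \<Omega> v)) [0..<m]"
    (is "map ?l _ = map ?r _") for v
  proof (rule map_cong[OF refl])
    fix a assume "a \<in> set [0..<m]"
    then have "\<pi> a < m" using permutes_in_image[OF \<pi>, of a] by simp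
    moreover have "\<pi> a = i \<longleftrightarrow> a = k" using k permutes_inj[OF \<pi>] by (metis injD)
    ultimately show "?l a = ?r a" using vs by (auto simp: nth_list_update)
  qed
  have L: "clinear (\<lambda>x. F (map ((\<lambda>a. \<Omega> (vs ! \<pi> a))(k := x)) [0..<m]))"
    using F k by (simp add: slot_linear_def)
  show "linear (\<lambda>v. of_int (sign \<pi>) * F (map (\<lambda>a. \<Omega> (((\<lambda>a. vs[i := v] ! a) \<circ> \<pi>) a)) [0..<m]))"
    unfolding eq
    by (rule linearI) (simp_all only: \<Omega> clinear_add[OF L] clinear_scaleC[OF L], simp_all add: algebra_simps scaleR_conv_of_real)
qed

lemma kappa_in_diff_forms:
  fixes f :: "complex^'n \<Rightarrow> 'b::topological_complex_algebra"
  assumes U: "open (resolvent_set f)" and om: "\<And>i. holomorphic_tva (omega f i) (resolvent_set f)"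
    and \<phi>: "\<phi> \<in> cont_multilinear (Suc p)"
  shows "kappa f p \<phi> \<in> diff_forms (Suc p) (resolvent_set f)"
proof -
  let ?U = "resolvent_set f"
  note F = cont_multilinear_slot_linear[OF \<phi>]
  note K = kappa_eq_alt_sum[OF F]
  have "linear (\<lambda>v. kappa f p \<phi> x (vs[i := v]))" if "x \<in> ?U" "length vs = Suc p" "i < Suc p" for x vs i
    using that alt_sum_slot_linear[OF F that(3,2), of "omega_at f x"]
    by (simp add: K omega_at_add omega_at_scaleR)
  moreover have "kappa f p \<phi> x vs = 0"
    if "x \<in> ?U" "length vs = Suc p" "i < j" "j < Suc p" "vs ! i = vs ! j" for x vs i j
    unfolding K[OF that(1,2)] using that by (intro alt_sum_repeated_zero[of i _ j]) auto
  moreover have "smooth_on (\<lambda>x. kappa f p \<phi> x vs) ?U" if vs: "length vs = Suc p" for vs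
  proof -
    have "sep_holo (\<lambda>z. alt_sum (Suc p) (\<lambda>u. \<phi> (map (\<lambda>a. omega_at f z (u a)) [0..<Suc p])) (\<lambda>a. vs ! a)) ?U"
      unfolding alt_sum_def
      by (intro sep_holo_sum sep_holo_cmult cont_multilinear_sep_holo[OF \<phi> U] omega_at_holomorphic om)
    then have "smooth_on (\<lambda>z. alt_sum (Suc p) (\<lambda>u. \<phi> (map (\<lambda>a. omega_at f z (u a)) [0..<Suc p])) (\<lambda>a. vs ! a)) ?U"
      by (rule sep_holo_smooth[OF U])
    moreover have "smooth_on (\<lambda>x. kappa f p \<phi> x vs) ?U \<longleftrightarrow>
        smooth_on (\<lambda>z. alt_sum (Suc p) (\<lambda>u. \<phi> (map (\<lambda>a. omega_at f z (u a)) [0..<Suc p])) (\<lambda>a. vs ! a)) ?U"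
      by (intro smooth_on_cong U K vs)
    ultimately show ?thesis by blast
  qed
  ultimately show ?thesis
    unfolding diff_forms_def by (auto simp: kappa_def)
qed

section \<open>The Hochschild coboundary under alternation\<close>

text \<open>
  The \<open>k\<close>-th summand of the Hochschild coboundary without its sign, as a function of \<open>m + 1\<close> vectors: the
  \<open>k\<close>-th and the following argument are multiplied. The cycle skips index \<open>k\<close>, and the entry \<open>k\<close>, which would be the
  argument \<open>k + 1\<close> alone, is overwritten by the product.
\<close>

definition merged :: "nat \<Rightarrow> ('b::topological_complex_algebra list \<Rightarrow> complex) \<Rightarrow> ('v \<Rightarrow> 'b) \<Rightarrow> nat \<Rightarrow> (nat \<Rightarrow> 'v) \<Rightarrow> complex"
  where "merged m \<phi> \<Omega> k u =
    \<phi> (map ((\<lambda>l. \<Omega> (u (shift_to_end m k l)))(k := \<Omega> (u k) * \<Omega> (u (Suc k)))) [0..<m])"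

lemma hochschild_b_merged:
  assumes m: "m > 0"
  shows "hochschild_b m \<phi> (map (\<lambda>a. \<Omega> (u a)) [0..<Suc m])
    = (\<Sum>j<m. (- 1) ^ j * merged m \<phi> \<Omega> j u)
      + (- 1) ^ m * \<phi> (map ((\<lambda>l. \<Omega> (u l))(0 := \<Omega> (u m) * \<Omega> (u 0))) [0..<m])"
proof -
  let ?as = "map (\<lambda>a. \<Omega> (u a)) [0..<Suc m]"
  have nth_as: "?as ! l = \<Omega> (u l)" if "l \<le> m" for l
    using that nth_map_upt[of l "Suc m" 0] by simp
  have len_as: "length ?as = Suc m" by simp
  have "take j ?as @ (?as ! j * ?as ! Suc j) # drop (j + 2) ?as
      = map ((\<lambda>l. \<Omega> (u (shift_to_end m j l)))(j := \<Omega> (u j) * \<Omega> (u (Suc j)))) [0..<m]"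
    if j: "j < m" for j
  proof (rule nth_equalityI)
    show "length (take j ?as @ (?as ! j * ?as ! Suc j) # drop (j + 2) ?as)
      = length (map ((\<lambda>l. \<Omega> (u (shift_to_end m j l)))(j := \<Omega> (u j) * \<Omega> (u (Suc j)))) [0..<m])"
      using j by simp
    fix l assume "l < length (take j ?as @ (?as ! j * ?as ! Suc j) # drop (j + 2) ?as)"
    then have l: "l < m" using j by simp
    show "(take j ?as @ (?as ! j * ?as ! Suc j) # drop (j + 2) ?as) ! l
      = map ((\<lambda>l. \<Omega> (u (shift_to_end m j l)))(j := \<Omega> (u j) * \<Omega> (u (Suc j)))) [0..<m] ! l"
      using j l len_as
      by (simp add: nth_append nth_as shift_to_end_def nth_Cons' del: upt_Suc map_append)
  qed
  moreover have "(?as ! m * ?as ! 0) # butlast (tl ?as)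
      = map ((\<lambda>l. \<Omega> (u l))(0 := \<Omega> (u m) * \<Omega> (u 0))) [0..<m]"
  proof (rule nth_equalityI)
    show "length ((?as ! m * ?as ! 0) # butlast (tl ?as))
      = length (map ((\<lambda>l. \<Omega> (u l))(0 := \<Omega> (u m) * \<Omega> (u 0))) [0..<m])"
      using m by simp
    fix l assume "l < length ((?as ! m * ?as ! 0) # butlast (tl ?as))"
    then have l: "l < m" using m by simp
    show "((?as ! m * ?as ! 0) # butlast (tl ?as)) ! l
      = map ((\<lambda>l. \<Omega> (u l))(0 := \<Omega> (u m) * \<Omega> (u 0))) [0..<m] ! l"
      using m l len_as
      by (simp add: nth_as nth_Cons' nth_butlast nth_tl del: upt_Suc map_append)
  qed
  ultimately show ?thesis
    unfolding hochschild_b_def merged_def using len_as by (simp del: upt_Suc)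
qed

lemma clinear_mult_right: "clinear L \<Longrightarrow> clinear (\<lambda>x. L (x * c))"
  and clinear_mult_left: "clinear L \<Longrightarrow> clinear (\<lambda>x. L (c * x))"
  for L :: "'b::topological_complex_algebra \<Rightarrow> complex"
  by (simp_all add: clinear_iff distrib_left distrib_right mult_scaleC_left mult_scaleC_right)

lemma clinear_lincomb:
  "clinear (\<lambda>x. \<Sum>j\<in>X. c j * L j x)" if "\<And>j. j \<in> X \<Longrightarrow> clinear (L j)"
  using that by (simp add: clinear_iff distrib_left sum.distrib sum_distrib_left mult.left_commute)

lemma clinear_add_cmult: "clinear L \<Longrightarrow> clinear L' \<Longrightarrow> clinear (\<lambda>x. L x + c * L' x)"
  by (simp add: clinear_iff distrib_left mult.left_commute)

text \<open>
  The four cases say where the argument \<open>i\<close> ends up: as the left or the right factor of the product, or unchanged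
  before or, with its index lowered by one, after it.
\<close>

lemma merged_clinear:
  assumes \<phi>: "\<phi> \<in> cont_multilinear m" and j: "j < m" and i: "i \<le> m"
  shows "clinear (\<lambda>x. merged m \<phi> (\<lambda>y. y) j (a(i := x)))"
proof -
  define b where "b l = a (shift_to_end m j l)" for l
  define b' where "b' = b(j := a j * a (Suc j))"
  note L = cont_multilinear_clinear[OF \<phi>]
  consider "i = j" | "i = Suc j" | "i < j" | k where "i = Suc k" "j < k" "k < m"
    using i j by (metis Suc_lessI less_Suc_eq_le linorder_neqE_nat not0_implies_Suc not_less_zero less_imp_Suc_add Suc_le_lessD)
  then show ?thesis
  proof cases
    case 1
    then have "merged m \<phi> (\<lambda>y. y) j (a(i := x)) = \<phi> (map (b(j := x * a (Suc j))) [0..<m])" for x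
      unfolding merged_def by (intro arg_cong[where f = \<phi>]) (auto simp: b_def shift_to_end_def)
    then show ?thesis using clinear_mult_right[OF L[OF j]] by simp
  next
    case 2
    then have "merged m \<phi> (\<lambda>y. y) j (a(i := x)) = \<phi> (map (b(j := a j * x)) [0..<m])" for x
      unfolding merged_def by (intro arg_cong[where f = \<phi>]) (auto simp: b_def shift_to_end_def)
    then show ?thesis using clinear_mult_left[OF L[OF j]] by simp
  next
    case 3
    then have "merged m \<phi> (\<lambda>y. y) j (a(i := x)) = \<phi> (map (b'(i := x)) [0..<m])" for x
      unfolding merged_def by (intro arg_cong[where f = \<phi>]) (auto simp: b_def b'_def shift_to_end_def)
    then show ?thesis using L[of i] 3 j by simp
  next
    case 4
    then have "merged m \<phi> (\<lambda>y. y) j (a(i := x)) = \<phi> (map (b'(k := x)) [0..<m])" for x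
      unfolding merged_def by (intro arg_cong[where f = \<phi>]) (auto simp: b_def b'_def shift_to_end_def)
    then show ?thesis using L[of k] 4 by simp
  qed
qed

lemma hochschild_b_slot_linear:
  assumes \<phi>: "\<phi> \<in> cont_multilinear m" and m: "m > 0"
  shows "slot_linear (Suc m) (hochschild_b m \<phi>)"
  unfolding slot_linear_def
proof (intro allI impI)
  fix a i assume "i < Suc m"
  then have i: "i \<le> m" by simp
  note L = cont_multilinear_clinear[OF \<phi>]
  have "clinear (\<lambda>x. \<phi> (map ((a(i := x))(0 := (a(i := x)) m * (a(i := x)) 0)) [0..<m]))"
  proof -
    consider "i = 0" | "i = m" | "0 < i" "i < m" using i by linarith
    then show ?thesis
    proof cases
      case 1
      have "clinear (\<lambda>x. \<phi> (map (a(0 := a m * x)) [0..<m]))"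
        by (rule clinear_mult_left[OF L[OF m]])
      then show ?thesis using 1 m by simp
    next
      case 2
      have "clinear (\<lambda>x. \<phi> (map (a(0 := x * a 0)) [0..<m]))"
        by (rule clinear_mult_right[OF L[OF m]])
      moreover have "map ((a(i := x))(0 := (a(i := x)) m * (a(i := x)) 0)) [0..<m] = map (a(0 := x * a 0)) [0..<m]" for x
        using 2 m by auto
      ultimately show ?thesis by (simp only:)
    next
      case 3
      have "clinear (\<lambda>x. \<phi> (map ((a(0 := a m * a 0))(i := x)) [0..<m]))"
        by (rule L[OF 3(2)])
      moreover have "(a(i := x))(0 := (a(i := x)) m * (a(i := x)) 0) = (a(0 := a m * a 0))(i := x)" for x
        using 3 by auto
      ultimately show ?thesis by simp
    qed
  qed
  moreover have "clinear (\<lambda>x. \<Sum>j<m. (- 1) ^ j * merged m \<phi> (\<lambda>y. y) j (a(i := x)))"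
    by (intro clinear_lincomb merged_clinear[OF \<phi> _ i]) simp
  ultimately show "clinear (\<lambda>x. hochschild_b m \<phi> (map (a(i := x)) [0..<Suc m]))"
    unfolding hochschild_b_merged[OF m, of \<phi> "\<lambda>y. y"] by (intro clinear_add_cmult)
qed

lemma cyclic_cochain_rotate:
  assumes \<phi>: "\<phi> \<in> cyclic_cochains q"
  shows "\<phi> (map a [0..<Suc q]) = (- 1) ^ q * \<phi> (map (\<lambda>l. if l = 0 then a q else a (l - 1)) [0..<Suc q])"
proof -
  have "last (map a [0..<Suc q]) # butlast (map a [0..<Suc q])
      = map (\<lambda>l. if l = 0 then a q else a (l - 1)) [0..<Suc q]"
    by (rule nth_equalityI) (auto simp: nth_Cons' nth_append less_Suc_eq)
  then show ?thesis using \<phi> by (simp add: cyclic_cochains_def del: upt_Suc)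
qed

text \<open>
  Rotating all vectors moves the product one place to the right and brings the first vector to the end; cyclicity
  of \<open>\<phi>\<close> brings it back to the front. The rotation of \<open>q + 2\<close> vectors has sign \<open>(-1)\<^bsup>q+1\<^esup>\<close>
  and cyclicity contributes \<open>(-1)\<^sup>q\<close>, so consecutive terms differ by a sign.
\<close>

lemma alt_sum_merged:
  assumes \<phi>: "\<phi> \<in> cyclic_cochains q"
  shows "k \<le> q \<Longrightarrow> alt_sum (Suc (Suc q)) (merged (Suc q) \<phi> \<Omega> k) u
      = (- 1) ^ k * alt_sum (Suc (Suc q)) (merged (Suc q) \<phi> \<Omega> 0) u"
proof (induction k)
  case (Suc k)
  let ?m = "Suc q"
  have "merged ?m \<phi> \<Omega> k (u \<circ> shift_to_end ?m 0) = (- 1) ^ q * merged ?m \<phi> \<Omega> (Suc k) u" for u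
    unfolding merged_def
    by (subst cyclic_cochain_rotate[OF \<phi>], intro arg_cong2[where f = "(*)"] arg_cong[where f = \<phi>] refl map_cong)
       (use Suc in \<open>auto simp: shift_to_end_def\<close>)
  then have "(- 1) ^ ?m * alt_sum (Suc ?m) (merged ?m \<phi> \<Omega> k) u
      = (- 1) ^ q * alt_sum (Suc ?m) (merged ?m \<phi> \<Omega> (Suc k)) u"
    using alt_sum_shift[of 0 ?m "merged ?m \<phi> \<Omega> k" u] by (simp add: alt_sum_cmult)
  then have "alt_sum (Suc ?m) (merged ?m \<phi> \<Omega> (Suc k)) u = - alt_sum (Suc ?m) (merged ?m \<phi> \<Omega> k) u"
    by (simp add: minus_one_power_iff split: if_splits)
  then show ?case using Suc by simp
qed simp

text \<open>
  The signs in the coboundary cancel those of the preceding lemma. The wrap-around term becomes the term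
  with the product in front by a rotation, whose sign cancels its own.
\<close>

lemma alt_sum_hochschild_b:
  assumes \<phi>: "\<phi> \<in> cyclic_cochains q"
  shows "alt_sum (Suc (Suc q)) (\<lambda>u. hochschild_b (Suc q) \<phi> (map (\<lambda>a. \<Omega> (u a)) [0..<Suc (Suc q)])) u
      = of_nat (q + 2) * alt_sum (Suc (Suc q)) (merged (Suc q) \<phi> \<Omega> 0) u"
proof -
  define m where "m = Suc q"
  define L where "L u = \<phi> (map ((\<lambda>l. \<Omega> (u l))(0 := \<Omega> (u m) * \<Omega> (u 0))) [0..<m])" for u
  have "L (u \<circ> shift_to_end m 0) = merged m \<phi> \<Omega> 0 u" for u
    unfolding L_def merged_def by (intro arg_cong[where f = \<phi>] map_cong) (auto simp: shift_to_end_def m_def)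
  then have L: "alt_sum (Suc m) (merged m \<phi> \<Omega> 0) u = (- 1) ^ m * alt_sum (Suc m) L u"
    using alt_sum_shift[of 0 m L u] by simp
  have M: "(- 1) ^ j * alt_sum (Suc m) (merged m \<phi> \<Omega> j) u = alt_sum (Suc m) (merged m \<phi> \<Omega> 0) u"
    if "j < m" for j
    using alt_sum_merged[OF \<phi>, of j \<Omega> u] that
    by (simp add: m_def mult.assoc[symmetric] power_add[symmetric] flip: mult_2)
  have "alt_sum (Suc m) (\<lambda>u. hochschild_b m \<phi> (map (\<lambda>a. \<Omega> (u a)) [0..<Suc m])) u
      = (\<Sum>j<m. (- 1) ^ j * alt_sum (Suc m) (merged m \<phi> \<Omega> j) u) + (- 1) ^ m * alt_sum (Suc m) L u"
  proof -
    have "(\<lambda>u. hochschild_b m \<phi> (map (\<lambda>a. \<Omega> (u a)) [0..<Suc m]))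
        = (\<lambda>u. (\<Sum>j<m. (- 1) ^ j * merged m \<phi> \<Omega> j u) + (- 1) ^ m * L u)"
      unfolding L_def by (rule ext, rule hochschild_b_merged) (simp add: m_def)
    then show ?thesis by (simp only: alt_sum_add alt_sum_cmult alt_sum_sum)
  qed
  also have "\<dots> = of_nat (Suc m) * alt_sum (Suc m) (merged m \<phi> \<Omega> 0) u"
    by (simp add: M L algebra_simps)
  finally show ?thesis by (simp add: m_def del: upt_Suc)
qed

section \<open>The exterior derivative of the forms attached to cochains\<close>

text \<open>
  By the Leibniz rule the exterior derivative is the alternating sum of the terms \<open>H k\<close>, in which
  \<open>\<omega>\<close> in slot \<open>k\<close> has been differentiated in the direction of the last vector. The cycle moving
  index \<open>k\<close> to the end turns \<open>H k\<close> into \<open>E k\<close>, where the direction of differentiation and the differentiated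
  vector are the neighbours \<open>k\<close> and \<open>k + 1\<close>. By the structure equation \<open>E k\<close> plus the corresponding product term
  is symmetric in these two, so its alternation vanishes.
\<close>

lemma ext_deriv_kappa_merged:
  fixes f :: "complex^'n \<Rightarrow> 'b::topological_complex_algebra"
  assumes f: "holomorphic_tva f UNIV" and U: "open (resolvent_set f)"
    and om: "\<And>i. holomorphic_tva (omega f i) (resolvent_set f)"
    and \<phi>: "\<phi> \<in> cont_multilinear (Suc p)"
    and z: "z \<in> resolvent_set f" and vs: "length vs = Suc (Suc p)"
  shows "ext_deriv (Suc p) (resolvent_set f) (kappa f p \<phi>) z vs
      = - (\<Sum>k<Suc p. (- 1) ^ k * alt_sum (Suc (Suc p)) (merged (Suc p) \<phi> (omega_at f z) k) (\<lambda>a. vs ! a))"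
proof -
  define m where "m = Suc p"
  define \<Omega> where "\<Omega> = omega_at f z"
  define D where "D = omega_deriv f z"
  define u0 where "u0 a = vs ! a" for a
  \<comment> \<open>The direction of differentiation is stored in the last place, as produced by \<open>alt_sum_Suc\<close>.\<close>
  define H where "H k u = \<phi> (map ((\<lambda>l. \<Omega> (u l))(k := D (u m) (u k))) [0..<m])" for k u
  define E where "E k u = H k (u \<circ> shift_to_end m k)" for k u
  note F = cont_multilinear_slot_linear[OF \<phi>]
  have deriv: "frechet_derivative (\<lambda>y. kappa f p \<phi> y (take i vs @ drop (Suc i) vs)) (at z) (vs ! i)
      = alt_sum m (\<lambda>u. \<Sum>k<m. H k u) (u0 \<circ> shift_to_end m i)" if i: "i \<le> m" for i
  proof -
    let ?w = "take i vs @ drop (Suc i) vs"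
    have w: "length ?w = Suc p" using vs i by (simp add: m_def)
    have w_nth: "?w ! a = (u0 \<circ> shift_to_end m i) a" if "a < m" for a
      using that i vs by (auto simp: nth_append shift_to_end_def u0_def m_def)
    let ?D = "\<lambda>v. \<Sum>\<pi> | \<pi> permutes {..<m}. of_int (sign \<pi>) *
        (\<Sum>k<m. \<phi> (map ((\<lambda>a. \<Omega> (?w ! \<pi> a))(k := D v (?w ! \<pi> k))) [0..<m]))"
    have "((\<lambda>y. alt_sum m (\<lambda>u. \<phi> (map (\<lambda>a. omega_at f y (u a)) [0..<m])) (\<lambda>a. ?w ! a)) has_derivative ?D) (at z)"
      unfolding alt_sum_def o_def \<Omega>_def D_def m_def
      by (intro has_derivative_sum has_derivative_mult_right
          omega_functional_has_derivative[OF \<phi> U om z])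
    then have "((\<lambda>y. kappa f p \<phi> y ?w) has_derivative ?D) (at z)"
      by (rule has_derivative_transform_within_open[OF _ U z]) (simp only: kappa_eq_alt_sum[OF F _ w] m_def)
    then have "frechet_derivative (\<lambda>y. kappa f p \<phi> y ?w) (at z) (vs ! i) = ?D (vs ! i)"
      by (simp only: frechet_derivative_at[symmetric])
    also have "\<dots> = alt_sum m (\<lambda>u. \<Sum>k<m. H k u) (u0 \<circ> shift_to_end m i)"
      unfolding alt_sum_def
    proof (intro sum.cong refl arg_cong2[where f = "(*)"])
      fix \<pi> k assume "\<pi> \<in> {\<pi>. \<pi> permutes {..<m}}" and "k \<in> {..<m}"
      then have \<pi>: "\<pi> permutes {..<m}" by simp
      have last: "(u0 \<circ> shift_to_end m i \<circ> \<pi>) m = vs ! i"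
        using i permutes_not_in[OF \<pi>, of m] by (simp add: shift_to_end_def u0_def)
      have init: "?w ! \<pi> a = (u0 \<circ> shift_to_end m i \<circ> \<pi>) a" if "a < m" for a
        using w_nth[of "\<pi> a"] permutes_in_image[OF \<pi>, of a] that by simp
      show "\<phi> (map ((\<lambda>a. \<Omega> (?w ! \<pi> a))(k := D (vs ! i) (?w ! \<pi> k))) [0..<m])
          = H k (u0 \<circ> shift_to_end m i \<circ> \<pi>)"
        unfolding H_def last by (intro arg_cong[where f = \<phi>] map_cong refl) (simp add: init del: o_apply)
    qed
    finally show ?thesis .
  qed
  \<comment> \<open>The transposition of \<open>k\<close> and \<open>k + 1\<close> affects slot \<open>k\<close> only, where it exchanges the two sides of the structure equation.\<close>
  have symmetric_zero: "alt_sum (Suc m) (\<lambda>u. E k u + merged m \<phi> \<Omega> k u) u0 = 0" if k: "k < m" for k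
  proof (rule alt_sum_symmetric_zero[where a = k and b = "Suc k"])
    fix \<pi> :: "nat \<Rightarrow> nat"
    define u where "u = u0 \<circ> \<pi>"
    define b where "b l = \<Omega> (u (shift_to_end m k l))" for l
    let ?\<tau> = "Transposition.transpose k (Suc k)"
    have L: "clinear (\<lambda>x. \<phi> (map (b(k := x)) [0..<m]))"
      using cont_multilinear_clinear[OF \<phi>] k by (simp only: m_def)
    have L_cont: "continuous_on UNIV (\<lambda>x. \<phi> (map (b(k := x)) [0..<m]))"
      using cont_multilinear_slot_continuous[OF \<phi>] by (simp only: m_def)
    have E: "E k u + merged m \<phi> \<Omega> k u
        = \<phi> (map (b(k := D (u k) (u (Suc k)) + \<Omega> (u k) * \<Omega> (u (Suc k)))) [0..<m])"
    proof -
      have "E k u = \<phi> (map (b(k := D (u k) (u (Suc k)))) [0..<m])"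
        unfolding E_def H_def by (intro arg_cong[where f = \<phi>]) (use k in \<open>auto simp: b_def shift_to_end_def\<close>)
      moreover have "merged m \<phi> \<Omega> k u = \<phi> (map (b(k := \<Omega> (u k) * \<Omega> (u (Suc k)))) [0..<m])"
        unfolding merged_def b_def ..
      ultimately show ?thesis by (simp only: clinear_add[OF L])
    qed
    have E': "E k (u \<circ> ?\<tau>) + merged m \<phi> \<Omega> k (u \<circ> ?\<tau>)
        = \<phi> (map (b(k := D (u (Suc k)) (u k) + \<Omega> (u (Suc k)) * \<Omega> (u k))) [0..<m])"
    proof -
      have fixed: "?\<tau> (shift_to_end m k l) = shift_to_end m k l" if "l < m" "l \<noteq> k" for l
        using that k by (auto simp: shift_to_end_def Transposition.transpose_def)
      have "E k (u \<circ> ?\<tau>) = \<phi> (map (b(k := D (u (Suc k)) (u k))) [0..<m])"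
        unfolding E_def H_def
        by (intro arg_cong[where f = \<phi>]) (use k fixed in \<open>auto simp: b_def shift_to_end_def[of m k m] shift_to_end_def[of m k k]\<close>)
      moreover have "merged m \<phi> \<Omega> k (u \<circ> ?\<tau>) = \<phi> (map (b(k := \<Omega> (u (Suc k)) * \<Omega> (u k))) [0..<m])"
        unfolding merged_def by (intro arg_cong[where f = \<phi>]) (use k fixed in \<open>auto simp: b_def\<close>)
      ultimately show ?thesis by (simp only: clinear_add[OF L])
    qed
    show "E k (u0 \<circ> \<pi> \<circ> ?\<tau>) + merged m \<phi> \<Omega> k (u0 \<circ> \<pi> \<circ> ?\<tau>) = E k (u0 \<circ> \<pi>) + merged m \<phi> \<Omega> k (u0 \<circ> \<pi>)"
      unfolding u_def[symmetric] E E' unfolding D_def \<Omega>_def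
      by (rule omega_structure_equation[OF f U om L L_cont z])
  qed (use k in auto)
  have E_sum: "(- 1) ^ m * alt_sum (Suc m) (H k) u0 = - ((- 1) ^ k * alt_sum (Suc m) (merged m \<phi> \<Omega> k) u0)"
    if k: "k < m" for k
  proof -
    have "alt_sum (Suc m) (E k) u0 = (- 1) ^ (m - k) * alt_sum (Suc m) (H k) u0"
    proof -
      have "E k = (\<lambda>u. H k (u \<circ> shift_to_end m k))" by (rule ext) (rule E_def)
      then show ?thesis using alt_sum_shift[of k m "H k" u0] k by simp
    qed
    moreover have "alt_sum (Suc m) (E k) u0 = - alt_sum (Suc m) (merged m \<phi> \<Omega> k) u0"
      using symmetric_zero[OF k] by (simp add: alt_sum_add add_eq_0_iff2)
    moreover have "(- 1) ^ m = (- 1) ^ k * ((- 1) ^ (m - k) :: complex)"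
      using k by (simp add: power_add[symmetric])
    ultimately show ?thesis by (metis mult.assoc mult_minus_right)
  qed
  have u0: "u0 = (\<lambda>a. vs ! a)" by (rule ext) (rule u0_def)
  have "ext_deriv m (resolvent_set f) (kappa f p \<phi>) z vs
      = (\<Sum>i\<le>m. (- 1) ^ i * alt_sum m (\<lambda>u. \<Sum>k<m. H k u) (u0 \<circ> shift_to_end m i))"
    using z vs by (simp add: ext_deriv_def m_def[symmetric] deriv)
  also have "\<dots> = (- 1) ^ m * alt_sum (Suc m) (\<lambda>u. \<Sum>k<m. H k u) u0"
    by (simp add: alt_sum_Suc mult.assoc[symmetric] power_add[symmetric] flip: mult_2)
  also have "\<dots> = - (\<Sum>k<m. (- 1) ^ k * alt_sum (Suc m) (merged m \<phi> \<Omega> k) u0)"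
    by (simp add: alt_sum_sum sum_distrib_left E_sum sum_negf)
  finally show ?thesis by (simp only: m_def \<Omega>_def u0)
qed

lemma cyclic_cochains_cont_multilinear: "\<phi> \<in> cyclic_cochains p \<Longrightarrow> \<phi> \<in> cont_multilinear (Suc p)"
  by (simp add: cyclic_cochains_def)

text \<open>
  Both sides are multiples of the alternation of the first summand of the coboundary: the exterior
  derivative has \<open>p + 1\<close> equal terms, the form of the coboundary has \<open>p + 2\<close>.
\<close>

lemma kappa_hochschild_b:
  fixes f :: "complex^'n \<Rightarrow> 'b::topological_complex_algebra"
  assumes f: "holomorphic_tva f UNIV" and U: "open (resolvent_set f)"
    and om: "\<And>i. holomorphic_tva (omega f i) (resolvent_set f)"
    and \<phi>: "\<phi> \<in> cyclic_cochains p"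
  shows "of_nat (p + 2) * ext_deriv (Suc p) (resolvent_set f) (kappa f p \<phi>) z vs
      = - of_nat (p + 1) * kappa f (Suc p) (hochschild_b (Suc p) \<phi>) z vs"
proof (cases "z \<in> resolvent_set f \<and> length vs = Suc (Suc p)")
  case True
  note cm = cyclic_cochains_cont_multilinear[OF \<phi>]
  let ?M = "\<lambda>k. alt_sum (Suc (Suc p)) (merged (Suc p) \<phi> (omega_at f z) k) (\<lambda>a. vs ! a)"
  have "ext_deriv (Suc p) (resolvent_set f) (kappa f p \<phi>) z vs = - (\<Sum>k<Suc p. (- 1) ^ k * ?M k)"
    using True by (intro ext_deriv_kappa_merged[OF f U om cm]) auto
  also have "(\<Sum>k<Suc p. (- 1) ^ k * ?M k) = (\<Sum>k<Suc p. ?M 0)"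
  proof (rule sum.cong[OF refl])
    fix k assume "k \<in> {..<Suc p}"
    then show "(- 1) ^ k * ?M k = ?M 0"
      using alt_sum_merged[OF \<phi>, of k "omega_at f z" "\<lambda>a. vs ! a"]
      by (simp add: mult.assoc[symmetric] power_add[symmetric] flip: mult_2)
  qed
  finally have "ext_deriv (Suc p) (resolvent_set f) (kappa f p \<phi>) z vs = - (of_nat (p + 1) * ?M 0)"
    by simp
  moreover have "kappa f (Suc p) (hochschild_b (Suc p) \<phi>) z vs = of_nat (p + 2) * ?M 0"
    using True kappa_eq_alt_sum[OF hochschild_b_slot_linear[OF cm], of z f vs]
      alt_sum_hochschild_b[OF \<phi>, of "omega_at f z" "\<lambda>a. vs ! a"] by (simp del: upt_Suc)
  ultimately show ?thesis
    by (simp only: mult_minus_left mult_minus_right mult.left_commute)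
next
  case False
  then show ?thesis by (auto simp: ext_deriv_def kappa_def)
qed

section \<open>Maps induced on quotients\<close>

text \<open>
  One closure condition, matching \<open>clinear_on\<close> below; sums and multiples are the cases \<open>c = 1\<close> and \<open>x = 0\<close>.
\<close>

definition csubspace :: "'a::complex_vector set \<Rightarrow> bool" where
  "csubspace N \<longleftrightarrow> 0 \<in> N \<and> (\<forall>x\<in>N. \<forall>y\<in>N. \<forall>c. x + c *\<^sub>C y \<in> N)"

text \<open>
  Linearity relative to a subspace: the exterior derivative is additive on smooth forms only, since
  the derivative of a non-differentiable function is an arbitrary value.
\<close>

definition clinear_on :: "'a::complex_vector set \<Rightarrow> ('a \<Rightarrow> 'c::complex_vector) \<Rightarrow> bool" where
  "clinear_on S T \<longleftrightarrow> (\<forall>x\<in>S. \<forall>y\<in>S. \<forall>c. T (x + c *\<^sub>C y) = T x + c *\<^sub>C T y)"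

lemma csubspace_add: "csubspace N \<Longrightarrow> x \<in> N \<Longrightarrow> y \<in> N \<Longrightarrow> x + y \<in> N"
  unfolding csubspace_def by (metis scaleC_one)

lemma csubspace_scaleC: "csubspace N \<Longrightarrow> y \<in> N \<Longrightarrow> c *\<^sub>C y \<in> N"
  unfolding csubspace_def by (metis add_0)

lemma clinear_on_zero: "clinear_on S T \<Longrightarrow> 0 \<in> S \<Longrightarrow> T 0 = 0"
  unfolding clinear_on_def by (metis add_0 add_cancel_left_right scaleC_one)

lemma csubspace_image:
  assumes S: "csubspace S" and T: "clinear_on S T"
  shows "csubspace (T ` S)"
proof -
  have "T x + c *\<^sub>C T y \<in> T ` S" if "x \<in> S" "y \<in> S" for x y c
  proof
    show "T x + c *\<^sub>C T y = T (x + c *\<^sub>C y)" using T that by (simp add: clinear_on_def)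
    show "x + c *\<^sub>C y \<in> S" using S that by (simp add: csubspace_def)
  qed
  moreover have "0 \<in> T ` S"
    using S clinear_on_zero[OF T] by (force simp: csubspace_def)
  ultimately show ?thesis by (auto simp: csubspace_def)
qed

text \<open>
  The image of a coset of \<open>N\<close> lies in a single coset of \<open>N'\<close>, and adding \<open>N'\<close> fills up that coset. This describes
  the induced map without a choice of representatives.
\<close>

lemma quotient_hom_induced:
  assumes T: "clinear_on UNIV T" and N: "csubspace N" and N': "csubspace N'"
    and Z: "T ` Z \<subseteq> Z'" and TN: "T ` N \<subseteq> N'"
  shows "quotient_hom Z N Z' N' (\<lambda>X. T ` X + N')"
    and "T ` (x +o N) + N' = T x +o N'"
proof -
  have T_add: "T (x + y) = T x + T y" for x y
    using T unfolding clinear_on_def by (metis UNIV_I scaleC_one)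
  have T_scale: "T (c *\<^sub>C x) = c *\<^sub>C T x" for c x
    using T clinear_on_zero[OF T] unfolding clinear_on_def by (metis UNIV_I add_0)
  have coset_eq: "T ` (x +o N) + N' = T x +o N'" for x
  proof (intro equalityI subsetI)
    fix y assume "y \<in> T ` (x +o N) + N'"
    then obtain n n' where "n \<in> N" "n' \<in> N'" "y = T (x + n) + n'"
      by (auto elim!: set_plus_elim simp: elt_set_plus_def)
    then show "y \<in> T x +o N'"
      using TN csubspace_add[OF N', of "T n" n'] by (auto simp: elt_set_plus_def T_add add.assoc)
  next
    fix y assume "y \<in> T x +o N'"
    then obtain n' where n': "n' \<in> N'" "y = T x + n'" by (auto simp: elt_set_plus_def)
    have "x \<in> x +o N" using N by (force simp: elt_set_plus_def csubspace_def)
    then show "y \<in> T ` (x +o N) + N'" using n' by blast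
  qed
  then show "T ` (x +o N) + N' = T x +o N'" .
  have add_cosets: "(x +o M) + (y +o M) = (x + y) +o M" if M: "csubspace M" for x y :: "'x::complex_vector" and M
  proof (intro equalityI subsetI)
    fix w assume "w \<in> (x +o M) + (y +o M)"
    then obtain a b where "a \<in> M" "b \<in> M" "w = (x + a) + (y + b)"
      by (auto elim!: set_plus_elim simp: elt_set_plus_def)
    then show "w \<in> (x + y) +o M"
      using csubspace_add[OF M, of a b] by (auto simp: elt_set_plus_def algebra_simps)
  next
    fix w assume "w \<in> (x + y) +o M"
    then obtain a where a: "a \<in> M" "w = (x + a) + (y + 0)" by (auto simp: elt_set_plus_def algebra_simps)
    then show "w \<in> (x +o M) + (y +o M)"
      using M unfolding csubspace_def by (blast intro: set_plus_intro set_plus_intro2)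
  qed
  have scale_coset: "coset_scale M c (x +o M) = (c *\<^sub>C x) +o M" if M: "csubspace M" for c and x :: "'x::complex_vector" and M
  proof (intro equalityI subsetI)
    fix w assume "w \<in> coset_scale M c (x +o M)"
    then obtain a b where "a \<in> M" "b \<in> M" "w = c *\<^sub>C (x + a) + b"
      by (auto elim!: set_plus_elim simp: elt_set_plus_def coset_scale_def)
    then show "w \<in> (c *\<^sub>C x) +o M"
      using csubspace_add[OF M csubspace_scaleC[OF M, of a c], of b]
      by (auto simp: elt_set_plus_def scaleC_add_right add.assoc)
  next
    fix w assume "w \<in> (c *\<^sub>C x) +o M"
    then obtain a where a: "a \<in> M" "w = c *\<^sub>C x + a" by (auto simp: elt_set_plus_def)
    have "x \<in> x +o M" using M by (force simp: elt_set_plus_def csubspace_def)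
    then show "w \<in> coset_scale M c (x +o M)"
      using a unfolding coset_scale_def by blast
  qed
  show "quotient_hom Z N Z' N' (\<lambda>X. T ` X + N')"
    unfolding quotient_hom_def
  proof (intro conjI ballI allI)
    show "(\<lambda>X. T ` X + N') ` quotient_space Z N \<subseteq> quotient_space Z' N'"
      using Z by (auto simp: quotient_space_def coset_eq)
    show "T ` (X + Y) + N' = (T ` X + N') + (T ` Y + N')"
      if "X \<in> quotient_space Z N" "Y \<in> quotient_space Z N" for X Y
      using that by (auto simp: quotient_space_def coset_eq add_cosets[OF N] add_cosets[OF N'] T_add)
    show "T ` coset_scale N c X + N' = coset_scale N' c (T ` X + N')"
      if "X \<in> quotient_space Z N" for c X
      using that by (auto simp: quotient_space_def coset_eq scale_coset[OF N] scale_coset[OF N'] T_scale)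
  qed
qed

section \<open>Linearity of the two complexes\<close>

lemma scaleC_apply: "(c *\<^sub>C \<psi>) x = c *\<^sub>C \<psi> x"
  by (simp add: scaleC_fun_def)

lemma lincomb_apply: "(\<phi> + c *\<^sub>C \<psi>) x = \<phi> x + c * (\<psi> x :: complex)"
  by (simp add: scaleC_fun_def scaleC_complex_def)

lemma csubspace_cont_multilinear: "csubspace (cont_multilinear k :: ('b::topological_complex_algebra list \<Rightarrow> complex) set)"
proof -
  have "\<phi> + c *\<^sub>C \<psi> \<in> cont_multilinear k"
    if \<phi>: "\<phi> \<in> cont_multilinear k" and \<psi>: "\<psi> \<in> cont_multilinear k"
    for \<phi> \<psi> :: "'b list \<Rightarrow> complex" and c
    unfolding cont_multilinear_def
  proof (intro CollectI conjI allI impI)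
    show "(\<phi> + c *\<^sub>C \<psi>) as = 0" if "length as \<noteq> k" for as
      using \<phi> \<psi> that by (simp add: cont_multilinear_def scaleC_apply scaleC_complex_def)
    show "clinear (\<lambda>x. (\<phi> + c *\<^sub>C \<psi>) (as[i := x]))" if "length as = k" "i < k" for as i
      unfolding lincomb_apply
      using \<phi> \<psi> that by (intro clinear_add_cmult) (auto simp: cont_multilinear_def)
    show "continuous_map (product_topology (\<lambda>_::nat. euclidean) {..<k}) euclidean
        (\<lambda>a. (\<phi> + c *\<^sub>C \<psi>) (map a [0..<k]))"
    proof -
      let ?X = "product_topology (\<lambda>_::nat. euclidean :: 'b topology) {..<k}"
      have "continuous_map ?X euclidean ((\<lambda>x. c * x) \<circ> (\<lambda>a. \<psi> (map a [0..<k])))"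
        by (rule continuous_map_compose[where X' = euclidean])
           (use \<psi> in \<open>auto simp: cont_multilinear_def intro!: continuous_intros\<close>)
      then show ?thesis
        unfolding lincomb_apply using \<phi> by (intro continuous_map_add) (auto simp: cont_multilinear_def o_def)
    qed
  qed
  moreover have "0 \<in> (cont_multilinear k :: ('b list \<Rightarrow> complex) set)"
    by (simp add: cont_multilinear_def clinear_iff)
  ultimately show ?thesis by (simp add: csubspace_def)
qed

lemma csubspace_cyclic_cochains: "csubspace (cyclic_cochains q)"
  using csubspace_cont_multilinear[of "Suc q"]
  by (auto simp: csubspace_def cyclic_cochains_def scaleC_apply scaleC_complex_def algebra_simps)

lemma hochschild_b_clinear_on: "clinear_on S (hochschild_b p)"
  unfolding clinear_on_def
  by (auto simp: fun_eq_iff hochschild_b_def scaleC_apply scaleC_complex_def algebra_simps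
      sum.distrib sum_distrib_left)

lemma csubspace_cyclic_coboundaries: "csubspace (cyclic_coboundaries q)"
proof (cases q)
  case 0
  then show ?thesis by (simp add: cyclic_coboundaries_def csubspace_def scaleC_zero_right)
next
  case (Suc r)
  then show ?thesis
    using csubspace_image[OF csubspace_cyclic_cochains hochschild_b_clinear_on]
    by (simp add: cyclic_coboundaries_def)
qed

lemma smooth_on_zero: "smooth_on (\<lambda>x. 0) U"
proof -
  have "Ck_on k (\<lambda>x. 0) U" for k
    by (induction k) simp_all
  then show ?thesis by (simp add: smooth_on_def)
qed

lemma linear_add_cmult:
  fixes g h :: "'v::real_vector \<Rightarrow> complex"
  shows "linear g \<Longrightarrow> linear h \<Longrightarrow> linear (\<lambda>v. g v + c * h v)"
  by (simp add: linear_iff algebra_simps scaleR_conv_of_real)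

lemma csubspace_diff_forms:
  assumes U: "open U"
  shows "csubspace (diff_forms k U)"
proof -
  have "\<alpha> + c *\<^sub>C \<beta> \<in> diff_forms k U" if "\<alpha> \<in> diff_forms k U" "\<beta> \<in> diff_forms k U" for \<alpha> \<beta> c
    using that unfolding diff_forms_def
    by (simp add: scaleC_apply scaleC_complex_def linear_add_cmult smooth_on_add_cmult[OF U])
  moreover have "0 \<in> diff_forms k U"
    by (simp add: diff_forms_def smooth_on_zero linear_zero)
  ultimately show ?thesis by (simp add: csubspace_def)
qed

lemma ext_deriv_clinear_on: "clinear_on (diff_forms k U) (ext_deriv k U)"
  unfolding clinear_on_def
proof (intro ballI allI ext)
  fix \<alpha> \<beta> c x vs assume \<alpha>: "\<alpha> \<in> diff_forms k U" and \<beta>: "\<beta> \<in> diff_forms k U"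
  show "ext_deriv k U (\<alpha> + c *\<^sub>C \<beta>) x vs = (ext_deriv k U \<alpha> + c *\<^sub>C ext_deriv k U \<beta>) x vs"
  proof (cases "x \<in> U \<and> length vs = Suc k")
    case True
    have "frechet_derivative (\<lambda>y. (\<alpha> + c *\<^sub>C \<beta>) y (take i vs @ drop (Suc i) vs)) (at x) (vs ! i)
        = frechet_derivative (\<lambda>y. \<alpha> y (take i vs @ drop (Suc i) vs)) (at x) (vs ! i)
          + c * frechet_derivative (\<lambda>y. \<beta> y (take i vs @ drop (Suc i) vs)) (at x) (vs ! i)"
      if i: "i \<le> k" for i
    proof -
      let ?w = "take i vs @ drop (Suc i) vs"
      have w: "length ?w = k" using True i by simp
      have D: "(\<lambda>y. \<gamma> y ?w) differentiable (at x)" if "\<gamma> \<in> diff_forms k U" for \<gamma>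
      proof -
        have "Ck_on (Suc 0) (\<lambda>y. \<gamma> y ?w) U"
          using that w unfolding diff_forms_def smooth_on_def by blast
        then show ?thesis using True by simp
      qed
      have "((\<lambda>y. \<alpha> y ?w + c * \<beta> y ?w) has_derivative
          (\<lambda>v. frechet_derivative (\<lambda>y. \<alpha> y ?w) (at x) v + c * frechet_derivative (\<lambda>y. \<beta> y ?w) (at x) v)) (at x)"
        using D[OF \<alpha>] D[OF \<beta>]
        by (intro has_derivative_add has_derivative_mult_right) (simp_all add: frechet_derivative_works)
      from frechet_derivative_at[OF this, symmetric] show ?thesis
        by (simp add: scaleC_apply scaleC_complex_def)
    qed
    then show ?thesis
      using True by (simp add: ext_deriv_def scaleC_apply scaleC_complex_def sum.distrib sum_distrib_left
          distrib_left mult.left_commute)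
  next
    case False
    then show ?thesis by (auto simp: ext_deriv_def scaleC_apply scaleC_complex_def)
  qed
qed

lemma csubspace_exact_forms: "open U \<Longrightarrow> csubspace (exact_forms (Suc r) U)"
  unfolding exact_forms_def
  using csubspace_image[OF csubspace_diff_forms ext_deriv_clinear_on] by simp

lemma kappa_clinear_on: "clinear_on UNIV (kappa f p)"
  unfolding clinear_on_def
  by (auto simp: fun_eq_iff kappa_def eval_on_forms_def scaleC_apply scaleC_complex_def algebra_simps
      sum.distrib sum_distrib_left)

section \<open>The induced homomorphism\<close>

theorem corollary3p9:
  fixes f :: "complex^'n \<Rightarrow> 'b::topological_complex_algebra" and p :: nat
  assumes "holomorphic_tva f UNIV"
    and "resolvent_set f \<noteq> {}"
    and "open (resolvent_set f)"
    and "\<forall>i. holomorphic_tva (omega f i) (resolvent_set f)"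
  shows "(\<forall>\<phi>\<in>cyclic_cochains p. kappa f p \<phi> \<in> diff_forms (p + 1) (resolvent_set f)) \<and>
    (\<exists>h. quotient_hom (cyclic_cocycles p) (cyclic_coboundaries p)
            (closed_forms (p + 1) (resolvent_set f)) (exact_forms (p + 1) (resolvent_set f)) h \<and>
         (\<forall>\<phi>\<in>cyclic_cocycles p.
            kappa f p \<phi> \<in> closed_forms (p + 1) (resolvent_set f) \<and>
            h (\<phi> +o cyclic_coboundaries p)
              = kappa f p \<phi> +o exact_forms (p + 1) (resolvent_set f)))"
proof -
  define U where "U = resolvent_set f"
  have f: "holomorphic_tva f UNIV" and U: "open U" and om: "\<And>i. holomorphic_tva (omega f i) U"
    using assms by (simp_all add: U_def)
  have forms: "kappa f q \<phi> \<in> diff_forms (Suc q) U" if "\<phi> \<in> cyclic_cochains q" for \<phi> q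
    using kappa_in_diff_forms[OF U[unfolded U_def] om[unfolded U_def] cyclic_cochains_cont_multilinear[OF that]]
    by (simp add: U_def)
  note coboundary = kappa_hochschild_b[OF f U[unfolded U_def] om[unfolded U_def], folded U_def]
  have kappa_zero: "kappa f q 0 = 0" for q
    by (rule clinear_on_zero[OF kappa_clinear_on]) simp
  have closed: "kappa f p \<phi> \<in> closed_forms (Suc p) U" if "\<phi> \<in> cyclic_cocycles p" for \<phi>
  proof -
    have \<phi>: "\<phi> \<in> cyclic_cochains p" and b: "hochschild_b (Suc p) \<phi> = 0"
      using that by (simp_all add: cyclic_cocycles_def)
    have "ext_deriv (Suc p) U (kappa f p \<phi>) z vs = 0" for z vs
    proof -
      have "complex_of_nat (p + 2) \<noteq> 0" by (simp only: of_nat_eq_0_iff)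
      then show ?thesis
        using coboundary[OF \<phi>, of z vs] by (simp only: b kappa_zero zero_fun_apply mult_zero_right mult_eq_0_iff) blast
    qed
    then have "ext_deriv (Suc p) U (kappa f p \<phi>) = 0" by (simp add: fun_eq_iff)
    then show ?thesis using forms[OF \<phi>] by (simp add: closed_forms_def)
  qed
  note exact_subspace = csubspace_exact_forms[OF U]
  have exact: "kappa f p ` cyclic_coboundaries p \<subseteq> exact_forms (Suc p) U"
  proof (cases p)
    case 0
    then show ?thesis
      using exact_subspace[of 0] by (simp add: cyclic_coboundaries_def kappa_zero csubspace_def)
  next
    case (Suc r)
    have "kappa f (Suc r) (hochschild_b (Suc r) \<psi>) \<in> exact_forms (Suc (Suc r)) U" if \<psi>: "\<psi> \<in> cyclic_cochains r" for \<psi>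
    proof -
      \<comment> \<open>The form of \<open>b\<psi>\<close> is the exterior derivative of \<open>\<kappa>(\<psi>)\<close> up to this factor.\<close>
      define c where "c = - complex_of_nat (r + 2) / of_nat (r + 1)"
      have nz: "complex_of_nat (r + 1) \<noteq> 0" by (simp only: of_nat_eq_0_iff)
      have "kappa f (Suc r) (hochschild_b (Suc r) \<psi>) z vs = c * ext_deriv (Suc r) U (kappa f r \<psi>) z vs" for z vs
        using coboundary[OF \<psi>, of z vs] nz unfolding c_def by (simp add: field_simps del: of_nat_add of_nat_Suc)
      then have "kappa f (Suc r) (hochschild_b (Suc r) \<psi>) = c *\<^sub>C ext_deriv (Suc r) U (kappa f r \<psi>)"
        by (simp add: fun_eq_iff scaleC_fun_def scaleC_complex_def)
      moreover have "ext_deriv (Suc r) U (kappa f r \<psi>) \<in> exact_forms (Suc (Suc r)) U"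
        using forms[OF \<psi>] by (simp add: exact_forms_def)
      ultimately show ?thesis using csubspace_scaleC[OF exact_subspace] by simp
    qed
    then show ?thesis using Suc by (auto simp: cyclic_coboundaries_def)
  qed
  have "kappa f p ` cyclic_cocycles p \<subseteq> closed_forms (Suc p) U"
    using closed by blast
  note induced = quotient_hom_induced[OF kappa_clinear_on csubspace_cyclic_coboundaries exact_subspace this exact]
  show ?thesis
    unfolding U_def[symmetric] Suc_eq_plus1[symmetric]
    using forms closed induced by blast
qed

end
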